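(* Let $K$ be a field of characteristic $0$ with henselian valuation ring $A$, maximal ideal $\mathfrak{m}_A$, valuation $v$ and residue field of characteristic $p>0$, containing a primitive $p$-th root of unity $\zeta$; put $\mathfrak{z}=\zeta-1$. Let $L|K$ be a Kummer extension of degree $p$ with defect $p$, $B$ the integral closure of $A$ in $L$. Let $\mathfrak{A}'=\{h\in\mathfrak{A}: h\in A^\times,\ h-1\in\mathfrak{m}_A\}$ and $\mathscr{S}=\{\alpha\in L:\alpha^p\in\mathfrak{A}'\}$. For each $\alpha\in\mathscr{S}$ there is $\alpha'\in B^\times\cap(\alpha-1)K^\times$, namely $\alpha'=\gamma_\alpha(\alpha-1)/\mathfrak{z}$ with $\gamma_\alpha\in A$ chosen so that $\alpha'\in B^\times$, such that $B=\bigcup_{\alpha\in\mathscr{S}}A[\alpha']$ is a filtered union, i.e.: (i) for any $\alpha_1,\alpha_2\in\mathscr{S}$, either $A[\alpha_1']\subset A[\alpha_2']$ or $A[\alpha_2']\subset A[\alpha_1']$; (ii) for every $\beta\in B$ there exists $\alpha\in\mathscr{S}$ with $\beta\in A[\alpha']$.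
   Context: $\mathfrak{A}$ is the set of $h\in K$ such that the solutions of $X^p=h$ generate $L$ over $K$. With $w$ the extension of $v$ to $L$, $k,l$ the residue fields, $e=(w(L^\times):v(K^\times))$, $f=[l:k]$, the defect $d$ is given by $p=def$; here $d=p$ (so $e=f=1$). The ring $A[\alpha']$ does not depend on the choice of $\gamma_\alpha$. *)

theory Defs
  imports "HOL-Computational_Algebra.Polynomial"
begin

text \<open>The big field L is the whole type 'a; subfields / subrings are subsets.\<close>

definition subfield :: "'a::field set \<Rightarrow> bool" where
  "subfield K \<longleftrightarrow> 0 \<in> K \<and> 1 \<in> K \<and>
     (\<forall>x\<in>K. \<forall>y\<in>K. x + y \<in> K \<and> x - y \<in> K \<and> x * y \<in> K) \<and>
     (\<forall>x\<in>K. inverse x \<in> K)"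

definition subring :: "'a::field set \<Rightarrow> bool" where
  "subring A \<longleftrightarrow> 0 \<in> A \<and> 1 \<in> A \<and>
     (\<forall>x\<in>A. \<forall>y\<in>A. x + y \<in> A \<and> x - y \<in> A \<and> x * y \<in> A)"

definition valuation_ring :: "'a::field set \<Rightarrow> 'a set \<Rightarrow> bool" where
  "valuation_ring K A \<longleftrightarrow> subring A \<and> A \<subseteq> K \<and>
     (\<forall>x\<in>K. x \<noteq> 0 \<longrightarrow> x \<in> A \<or> inverse x \<in> A)"

definition ring_units :: "'a::field set \<Rightarrow> 'a set" where
  "ring_units A = {x \<in> A. x \<noteq> 0 \<and> inverse x \<in> A}"

definition max_ideal :: "'a::field set \<Rightarrow> 'a set" where
  "max_ideal A = A - ring_units A"

definition poly_over :: "'a::field set \<Rightarrow> 'a poly \<Rightarrow> bool" where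
  "poly_over A f \<longleftrightarrow> (\<forall>i. coeff f i \<in> A)"

definition henselian :: "'a::field set \<Rightarrow> bool" where
  "henselian A \<longleftrightarrow> (\<forall>f a. poly_over A f \<and> lead_coeff f = 1 \<and> a \<in> A \<and>
       poly f a \<in> max_ideal A \<and> poly (pderiv f) a \<in> ring_units A \<longrightarrow>
       (\<exists>b\<in>A. poly f b = 0 \<and> b - a \<in> max_ideal A))"

definition integral_closure :: "'a::field set \<Rightarrow> 'a set" where
  "integral_closure A = {x. \<exists>f. poly_over A f \<and> lead_coeff f = 1 \<and> poly f x = 0}"

definition ring_adj :: "'a::field set \<Rightarrow> 'a \<Rightarrow> 'a set" where
  "ring_adj A x = {poly f x |f. poly_over A f}"

definition generates :: "'a::field set \<Rightarrow> 'a set \<Rightarrow> bool" where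
  "generates K S \<longleftrightarrow> (\<forall>F. subfield F \<and> K \<subseteq> F \<and> S \<subseteq> F \<longrightarrow> F = UNIV)"

definition ext_degree :: "'a::field set \<Rightarrow> nat \<Rightarrow> bool" where
  "ext_degree K n \<longleftrightarrow> (\<exists>b :: nat \<Rightarrow> 'a.
     (\<forall>x. \<exists>c. (\<forall>i<n. c i \<in> K) \<and> x = (\<Sum>i<n. c i * b i)) \<and>
     (\<forall>c. (\<forall>i<n. c i \<in> K) \<and> (\<Sum>i<n. c i * b i) = 0 \<longrightarrow> (\<forall>i<n. c i = 0)))"

definition kummer_ext :: "'a::field set \<Rightarrow> nat \<Rightarrow> bool" where
  "kummer_ext K n \<longleftrightarrow> ext_degree K n \<and> (\<exists>\<theta>. \<theta> ^ n \<in> K \<and> generates K {\<theta>})"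

definition primitive_root :: "nat \<Rightarrow> 'a::field \<Rightarrow> bool" where
  "primitive_root n z \<longleftrightarrow> z ^ n = 1 \<and> (\<forall>k. 0 < k \<and> k < n \<longrightarrow> z ^ k \<noteq> 1)"

definition kummer_gens :: "'a::field set \<Rightarrow> nat \<Rightarrow> 'a set" where
  "kummer_gens K p = {h \<in> K. generates K {x. x ^ p = h}}"

text \<open>Defect p for an extension OL of A to L: ramification index e = 1 and
  residue degree f = 1.\<close>
definition ram_index_one :: "'a::field set \<Rightarrow> 'a set \<Rightarrow> bool" where
  "ram_index_one K OL \<longleftrightarrow> (\<forall>x. x \<noteq> 0 \<longrightarrow> (\<exists>c\<in>K. c \<noteq> 0 \<and> x / c \<in> ring_units OL))"

definition res_degree_one :: "'a::field set \<Rightarrow> 'a set \<Rightarrow> bool" where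
  "res_degree_one A OL \<longleftrightarrow> (\<forall>x\<in>OL. \<exists>a\<in>A. x - a \<in> max_ideal OL)"

end

theory Submission
  imports Defs "Jordan_Normal_Form.Char_Poly"
begin

text \<open>Since \<open>L|K\<close> is immediate, no \<open>\<alpha> \<in> L - K\<close> has a best approximation in \<open>K\<close>. Hensel's lemma shows that a
  polynomial \<open>F\<close> over \<open>K\<close> of degree less than \<open>p\<close> cannot distinguish \<open>\<alpha>\<close> from its approximations: for
  \<open>c \<in> K\<close> close to \<open>\<alpha>\<close> all terms \<open>F\<^sub>k(c) (\<alpha> - c)^k\<close> of the Taylor expansion of \<open>F(\<alpha>)\<close> at \<open>c\<close> have value at
  least \<open>v(F(\<alpha>))\<close>. Replacing \<open>\<alpha> \<equiv> 1\<close> by \<open>\<alpha>/c\<close> therefore writes a given integral element as a polynomial over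
  \<open>A\<close> in \<open>\<alpha>'\<close>. Hensel's lemma also gives \<open>v(\<alpha> - 1) \<le> v(\<zeta> - 1)\<close>, so that \<open>\<gamma>\<close> exists in \<open>A\<close> and all conjugates of
  \<open>\<alpha>'\<close> are integral; hence \<open>B\<close> is the whole valuation ring of \<open>L\<close>. The rings \<open>A[\<alpha>']\<close> form a chain because
  \<open>\<alpha>\<^sub>1 = c \<alpha>\<^sub>2^j\<close> by Kummer theory.\<close>

section \<open>Polynomials over subrings\<close>

hide_const (open) Module.smult

lemma subfield_subring: "subfield K \<Longrightarrow> subring K"
  by (auto simp: subfield_def subring_def)

locale base_subring =
  fixes R :: "'a::field set"
  assumes R: "subring R"
begin

lemma zero_mem [simp]: "0 \<in> R" and one_mem [simp]: "1 \<in> R"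
  and add_mem: "x \<in> R \<Longrightarrow> y \<in> R \<Longrightarrow> x + y \<in> R"
  and diff_mem: "x \<in> R \<Longrightarrow> y \<in> R \<Longrightarrow> x - y \<in> R"
  and mult_mem: "x \<in> R \<Longrightarrow> y \<in> R \<Longrightarrow> x * y \<in> R"
  using R by (auto simp: subring_def)

lemma uminus_mem: "x \<in> R \<Longrightarrow> - x \<in> R"
  using diff_mem[of 0 x] by simp

lemma sum_mem: "(\<And>i. i \<in> I \<Longrightarrow> f i \<in> R) \<Longrightarrow> sum f I \<in> R"
  by (induction I rule: infinite_finite_induct) (auto intro: add_mem)

lemma prod_mem: "(\<And>i. i \<in> I \<Longrightarrow> f i \<in> R) \<Longrightarrow> prod f I \<in> R"
  by (induction I rule: infinite_finite_induct) (auto intro: mult_mem)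

lemma power_mem: "x \<in> R \<Longrightarrow> x ^ n \<in> R"
  by (induction n) (auto intro: mult_mem)

lemma of_nat_mem: "of_nat n \<in> R"
  by (induction n) (auto intro: add_mem)

lemmas mem_intros = add_mem diff_mem mult_mem uminus_mem sum_mem prod_mem power_mem of_nat_mem

lemma poly_over_add: "poly_over R f \<Longrightarrow> poly_over R g \<Longrightarrow> poly_over R (f + g)"
  and poly_over_diff: "poly_over R f \<Longrightarrow> poly_over R g \<Longrightarrow> poly_over R (f - g)"
  and poly_over_smult: "c \<in> R \<Longrightarrow> poly_over R f \<Longrightarrow> poly_over R (smult c f)"
  and poly_over_monom: "c \<in> R \<Longrightarrow> poly_over R (monom c n)"
  and poly_over_pderiv: "poly_over R f \<Longrightarrow> poly_over R (pderiv f)"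
  by (auto simp: poly_over_def coeff_pderiv simp del: of_nat_Suc intro!: mem_intros)

lemma poly_over_0 [simp]: "poly_over R 0"
  and poly_over_1 [simp]: "poly_over R 1"
  by (auto simp: poly_over_def)

lemma poly_over_mult: "poly_over R f \<Longrightarrow> poly_over R g \<Longrightarrow> poly_over R (f * g)"
  by (auto simp: poly_over_def coeff_mult intro!: mem_intros)

lemma poly_over_pCons: "a \<in> R \<Longrightarrow> poly_over R f \<Longrightarrow> poly_over R (pCons a f)"
  by (auto simp: poly_over_def coeff_pCons split: nat.split)

lemma poly_over_pConsD:
  assumes "poly_over R (pCons a f)" shows "a \<in> R" "poly_over R f"
  using assms[unfolded poly_over_def, THEN spec, of 0]
    assms[unfolded poly_over_def, THEN spec, of "Suc _"] by (auto simp: poly_over_def)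

lemma poly_over_sum: "(\<And>i. i \<in> I \<Longrightarrow> poly_over R (f i)) \<Longrightarrow> poly_over R (sum f I)"
  by (induction I rule: infinite_finite_induct) (auto intro: poly_over_add)

lemma poly_over_prod: "(\<And>i. i \<in> I \<Longrightarrow> poly_over R (f i)) \<Longrightarrow> poly_over R (prod f I)"
  by (induction I rule: infinite_finite_induct) (auto intro: poly_over_mult)

lemma poly_over_power: "poly_over R f \<Longrightarrow> poly_over R (f ^ n)"
  by (induction n) (auto intro: poly_over_mult)

lemma poly_over_pcompose: "poly_over R f \<Longrightarrow> poly_over R g \<Longrightarrow> poly_over R (pcompose f g)"
proof (induction f)
  case (pCons a f)
  then show ?case
    using poly_over_pConsD[of a f]
    by (auto simp: pcompose_pCons intro!: poly_over_add poly_over_mult poly_over_pCons)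
qed simp

lemma poly_mem: "poly_over R f \<Longrightarrow> x \<in> R \<Longrightarrow> poly f x \<in> R"
  by (auto simp: poly_altdef poly_over_def intro!: mem_intros)

lemma ring_adj_mult: "x \<in> ring_adj R y \<Longrightarrow> x' \<in> ring_adj R y \<Longrightarrow> x * x' \<in> ring_adj R y"
  by (smt (verit, best) mem_Collect_eq poly_mult poly_over_mult ring_adj_def)

text \<open>The leading coefficient 1 makes division possible without inverses: \<open>H * D\<close>
  has the leading term of \<open>G\<close>, and the difference is divided by induction on the
  degree.\<close>

lemma division_by_monic:
  assumes "poly_over R D" "lead_coeff D = 1"
  shows "poly_over R G \<Longrightarrow>
    \<exists>Q S. poly_over R Q \<and> poly_over R S \<and> G = Q * D + S \<and> (S = 0 \<or> degree S < degree D)"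
proof (induction "degree G" arbitrary: G rule: less_induct)
  case less
  show ?case
  proof (cases "G = 0 \<or> degree G < degree D")
    case True
    then show ?thesis using less.prems by (intro exI[of _ 0] exI[of _ G]) auto
  next
    case False
    define H where "H = monom (lead_coeff G) (degree G - degree D)"
    have H: "poly_over R H"
      using less.prems by (auto simp: H_def poly_over_def)
    have D0: "D \<noteq> 0" using assms(2) by auto
    have degHD: "degree (H * D) = degree G"
      using False D0 by (auto simp: H_def degree_mult_eq degree_monom_eq monom_eq_0_iff)
    have lead: "lead_coeff (H * D) = lead_coeff G"
      using assms(2) False unfolding lead_coeff_mult by (simp add: H_def degree_monom_eq)
    have over: "poly_over R (G - H * D)"
      by (intro poly_over_diff poly_over_mult assms less.prems H)
    \<comment> \<open>The zero polynomial has degree 0, so for \<open>degree G = 0\<close> the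
      degree cannot drop; there the difference vanishes outright.\<close>
    consider "G - H * D = 0" | "degree (G - H * D) < degree G"
    proof (cases "degree G = 0")
      case True
      then have "degree (G - H * D) = 0"
        using degHD degree_diff_le_max[of G "H * D"] by simp
      moreover have "coeff (G - H * D) 0 = 0"
        using lead degHD True by simp
      ultimately have "G - H * D = 0"
        using leading_coeff_0_iff[of "G - H * D"] by simp
      then show ?thesis using that by blast
    next
      case False
      have "degree (G - H * D) < degree G"
      proof (rule degree_lessI)
        show "G - H * D \<noteq> 0 \<or> degree G > 0" using False by simp
        show "\<forall>k\<ge>degree G. coeff (G - H * D) k = 0"
        proof (intro allI impI)
          fix k assume "k \<ge> degree G"
          then show "coeff (G - H * D) k = 0"
            using lead degHD coeff_eq_0[of G k] coeff_eq_0[of "H * D" k]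
            by (cases "k = degree G") auto
        qed
      qed
      then show ?thesis using that by blast
    qed
    then show ?thesis
    proof cases
      case 1
      then show ?thesis using H by (intro exI[of _ H] exI[of _ 0]) auto
    next
      case 2
      then obtain Q S where QS: "poly_over R Q" "poly_over R S" "G - H * D = Q * D + S"
          "S = 0 \<or> degree S < degree D"
        using less.hyps[OF _ over] by blast
      then show ?thesis
        by (intro exI[of _ "Q + H"] exI[of _ S]) (auto intro: poly_over_add H simp: algebra_simps)
    qed
  qed
qed

lemma char_poly_over:
  assumes M: "M \<in> carrier_mat n n" and MR: "\<And>i j. i < n \<Longrightarrow> j < n \<Longrightarrow> M $$ (i, j) \<in> R"
  shows "poly_over R (char_poly M)"
proof -
  have cl: "char_poly_matrix M \<in> carrier_mat n n" using M by simp
  have sg: "poly_over R (signof q * f)" if "poly_over R f" for q :: "nat \<Rightarrow> nat" and f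
    using that poly_over_diff[of 0 f] by (cases q rule: sign_cases) auto
  show ?thesis
    unfolding char_poly_def det_def'[OF cl]
  proof (intro poly_over_sum sg poly_over_prod)
    fix q i assume "q \<in> {q. q permutes {0..<n}}" "i \<in> {0..<n}"
    then have "i < n" "q i < n" by (auto simp: permutes_in_image)
    then show "poly_over R (char_poly_matrix M $$ (i, q i))"
      using M MR[of i "q i"]
      by (auto simp: char_poly_matrix_def intro!: poly_over_add poly_over_pCons uminus_mem)
  qed
qed

text \<open>Cayley--Hamilton: multiplication by an element of \<open>R[y]\<close> on the spanning set
  \<open>1, y, \<dots>, y^(n-1)\<close> is given by a matrix over \<open>R\<close>.\<close>
lemma ring_adj_subset_integral_closure:
  assumes y: "y \<in> integral_closure R"
  shows "ring_adj R y \<subseteq> integral_closure R"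
proof
  fix x assume x: "x \<in> ring_adj R y"
  obtain D where D: "poly_over R D" "lead_coeff D = 1" "poly D y = 0"
    using y by (auto simp: integral_closure_def)
  define n where "n = degree D"
  \<comment> \<open>A monic polynomial of degree 0 is 1 and has no root. Later \<open>n > 0\<close>
    gives \<open>v\<close> the entry \<open>y ^ 0 = 1\<close>, so \<open>v\<close> is a genuine
    eigenvector.\<close>
  have n: "n > 0"
  proof (rule ccontr)
    assume "\<not> n > 0"
    then obtain d where "D = [:d:]" by (auto simp: n_def elim: degree_eq_zeroE)
    then show False using D by simp
  qed
  have red: "\<exists>c. (\<forall>i<n. c i \<in> R) \<and> w = (\<Sum>i<n. c i * y ^ i)" if "w \<in> ring_adj R y" for w
  proof -
    obtain G where G: "poly_over R G" "w = poly G y" using \<open>w \<in> ring_adj R y\<close> by (auto simp: ring_adj_def)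
    obtain Q S where S: "poly_over R S" "G = Q * D + S" "S = 0 \<or> degree S < n"
      using division_by_monic[OF D(1,2) G(1)] by (auto simp: n_def)
    have "w = poly S y" using S G D by simp
    also have "\<dots> = (\<Sum>i<n. coeff S i * y ^ i)"
      unfolding poly_altdef using S n
      by (intro sum.mono_neutral_left) (auto simp: coeff_eq_0)
    finally show ?thesis using S by (auto simp: poly_over_def)
  qed
  have pw: "y ^ i \<in> ring_adj R y" for i
    unfolding ring_adj_def using poly_over_monom[of 1 i]
    by (auto intro!: exI[of _ "monom 1 i"] simp: poly_monom)
  have "\<forall>i. \<exists>c. (\<forall>j<n. c j \<in> R) \<and> x * y ^ i = (\<Sum>j<n. c j * y ^ j)"
    by (intro allI red ring_adj_mult x pw)
  then obtain c where c: "\<And>i j. j < n \<Longrightarrow> c i j \<in> R" "\<And>i. x * y ^ i = (\<Sum>j<n. c i j * y ^ j)"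
    by metis
  define M where "M = mat n n (\<lambda>(i, j). c i j)"
  define v where "v = vec n (\<lambda>i. y ^ i)"
  have M: "M \<in> carrier_mat n n" by (simp add: M_def)
  have "M *\<^sub>v v = x \<cdot>\<^sub>v v"
  proof (rule eq_vecI)
    fix i assume "i < dim_vec (x \<cdot>\<^sub>v v)"
    then have i: "i < n" by (simp add: v_def)
    then show "(M *\<^sub>v v) $ i = (x \<cdot>\<^sub>v v) $ i"
      using c(2)[of i] by (simp add: M_def v_def scalar_prod_def lessThan_atLeast0)
  qed (simp_all add: M_def v_def)
  moreover have "v \<noteq> 0\<^sub>v n"
  proof
    assume "v = 0\<^sub>v n"
    then have "v $ 0 = 0" using n by simp
    then show False using n by (simp add: v_def)
  qed
  ultimately have "eigenvalue M x"
    unfolding eigenvalue_def eigenvector_def using M by (intro exI[of _ v]) (auto simp: v_def)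
  then have "poly (char_poly M) x = 0"
    using eigenvalue_root_char_poly[OF M] by simp
  moreover have "lead_coeff (char_poly M) = 1"
    using degree_monic_char_poly[OF M] by simp
  moreover have "poly_over R (char_poly M)"
    by (rule char_poly_over[OF M]) (simp add: M_def c)
  ultimately show "x \<in> integral_closure R"
    by (auto simp: integral_closure_def)
qed

end

locale base_subfield =
  fixes K :: "'a::field set"
  assumes K: "subfield K"
begin

sublocale base_subring K
  by unfold_locales (rule subfield_subring[OF K])

lemma inverse_mem: "x \<in> K \<Longrightarrow> inverse x \<in> K"
  and divide_mem: "x \<in> K \<Longrightarrow> y \<in> K \<Longrightarrow> x / y \<in> K"
  using K by (auto simp: subfield_def divide_inverse intro: mult_mem)

end

section \<open>Roots of unity and divisors of split polynomials\<close>

lemma bezout_prime: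
  assumes "prime (p::nat)" "0 < i" "i < p"
  obtains x y where "i * x = p * y + 1"
proof -
  have "coprime i p"
    using assms by (metis coprime_commute nat_dvd_not_less prime_imp_coprime)
  then show ?thesis
    using bezout_nat[of i p] assms(2) that by (auto simp: coprime_iff_gcd_eq_1)
qed

text \<open>Linear factors are removed one at a time: a root \<open>r k\<close> of \<open>g\<close>
  is divided out of both sides; otherwise \<open>[:- r k, 1:]\<close> divides the cofactor
  \<open>h\<close> and cancels.\<close>

lemma dvd_prod_linear_factors:
  fixes r :: "'b \<Rightarrow> 'a::field"
  assumes "finite J"
  shows "g dvd (\<Prod>j\<in>J. [:- r j, 1:]) \<Longrightarrow>
    \<exists>J' c. J' \<subseteq> J \<and> g = smult c (\<Prod>j\<in>J'. [:- r j, 1:])"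
  using assms
proof (induction J arbitrary: g rule: finite_induct)
  case empty
  then have "degree g = 0" by (simp add: poly_dvd_1)
  then obtain c where "g = [:c:]" by (rule degree_eq_zeroE)
  then show ?case by (intro exI[of _ "{}"] exI[of _ c]) simp
next
  case (insert k J)
  show ?case
  proof (cases "poly g (r k) = 0")
    case True
    then obtain g' where g': "g = [:- r k, 1:] * g'" by (auto simp: poly_eq_0_iff_dvd)
    then have "g' dvd (\<Prod>j\<in>J. [:- r j, 1:])"
      using insert by (simp only: prod.insert[OF insert.hyps] dvd_mult_cancel_left)
        (simp add: pCons_eq_0_iff)
    then obtain J' c where "J' \<subseteq> J" "g' = smult c (\<Prod>j\<in>J'. [:- r j, 1:])" using insert.IH by blast
    moreover from this have "finite J'" "k \<notin> J'" using insert.hyps finite_subset by auto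
    ultimately show ?thesis using g'
      by (intro exI[of _ "insert k J'"] exI[of _ c]) auto
  next
    case False
    have "g dvd [:- r k, 1:] * (\<Prod>j\<in>J. [:- r j, 1:])"
      using insert.prems by (simp only: prod.insert[OF insert.hyps])
    then obtain h where h: "[:- r k, 1:] * (\<Prod>j\<in>J. [:- r j, 1:]) = g * h"
      by (rule dvdE)
    have "poly (g * h) (r k) = 0" by (simp flip: h)
    then have "poly h (r k) = 0" using False by simp
    then obtain h' where h': "h = [:- r k, 1:] * h'" by (auto simp: poly_eq_0_iff_dvd)
    have "[:- r k, 1:] * (\<Prod>j\<in>J. [:- r j, 1:]) = [:- r k, 1:] * (g * h')"
      using h h' by (simp only: mult.assoc mult.left_commute)
    then have "(\<Prod>j\<in>J. [:- r j, 1:]) = g * h'"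
      by (simp only: mult_cancel_left) (simp add: pCons_eq_0_iff)
    then have "g dvd (\<Prod>j\<in>J. [:- r j, 1:])" by simp
    then show ?thesis using insert.IH by blast
  qed
qed

lemma primitive_root_inj:
  assumes "primitive_root n z" "i < n" "j < n" "z ^ i = z ^ j" "(z::'a::field) \<noteq> 0"
  shows "i = j"
proof -
  have aux: "i = j" if "i \<le> j" "i < n" "j < n" "z ^ i = z ^ j" for i j
  proof (rule ccontr)
    assume "i \<noteq> j"
    have "z ^ j = z ^ i * z ^ (j - i)" using \<open>i \<le> j\<close> by (simp flip: power_add)
    then have "z ^ (j - i) = 1" using that \<open>z \<noteq> 0\<close> by simp
    then show False using assms(1) that \<open>i \<noteq> j\<close> unfolding primitive_root_def by force
  qed
  show ?thesis using aux[of i j] aux[of j i] assms by (cases "i \<le> j") auto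
qed

lemma primitive_root_nonzero: "primitive_root n z \<Longrightarrow> 0 < n \<Longrightarrow> z \<noteq> (0::'a::field)"
  by (auto simp: primitive_root_def zero_power)

text \<open>Both sides are monic of degree \<open>n\<close> and agree at the \<open>n\<close> points
  \<open>z ^ j * x\<close>, which are distinct because \<open>z\<close> is primitive and
  \<open>x \<noteq> 0\<close>.\<close>

lemma power_minus_factorization:
  fixes x z :: "'a::field"
  assumes z: "primitive_root n z" and n: "0 < n" and x: "x \<noteq> 0"
  shows "monom 1 n - [:x ^ n:] = (\<Prod>j<n. [:- (z ^ j * x), 1:])"
proof (rule poly_eqI_degree_lead_coeff[where n = n and A = "(\<lambda>j. z ^ j * x) ` {..<n}"])
  have z0: "z \<noteq> 0" using primitive_root_nonzero[OF z n] .
  have "inj_on (\<lambda>j. z ^ j * x) {..<n}"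
    using primitive_root_inj[OF z] z0 x by (auto simp: inj_on_def)
  then show "n \<le> card ((\<lambda>j. z ^ j * x) ` {..<n})" by (simp add: card_image)
  show "degree (monom 1 n - [:x ^ n:]) \<le> n"
    by (rule order.trans[OF degree_diff_le_max]) (simp add: degree_monom_eq)
  have dp: "degree (\<Prod>j<n. [:- (z ^ j * x), 1:]) = n"
    by (subst degree_prod_eq_sum_degree) auto
  then show "degree (\<Prod>j<n. [:- (z ^ j * x), 1:]) \<le> n" by simp
  have "coeff (\<Prod>j<n. [:- (z ^ j * x), 1:]) n = lead_coeff (\<Prod>j<n. [:- (z ^ j * x), 1:])"
    by (simp add: dp)
  also have "\<dots> = 1" by (subst lead_coeff_prod) simp
  finally show "coeff (monom 1 n - [:x ^ n:]) n = coeff (\<Prod>j<n. [:- (z ^ j * x), 1:]) n"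
    using n by (simp add: coeff_pCons split: nat.split)
  fix y assume "y \<in> (\<lambda>j. z ^ j * x) ` {..<n}"
  then obtain j where j: "j < n" "y = z ^ j * x" by auto
  have "(z ^ j) ^ n = 1" using z by (metis power_mult mult.commute power_one primitive_root_def)
  then show "poly (monom 1 n - [:x ^ n:]) y = poly (\<Prod>j<n. [:- (z ^ j * x), 1:]) y"
    using j by (auto simp: poly_monom poly_prod power_mult_distrib intro!: prod_zero)
qed

section \<open>Kummer theory\<close>

locale kummer_root =
  fixes K :: "'a::field_char_0 set" and p :: nat and \<zeta> \<theta> :: 'a
  assumes K: "subfield K" and p: "prime p"
    and zeta: "\<zeta> \<in> K" "primitive_root p \<zeta>"
    and theta: "\<theta> ^ p \<in> K" "\<theta> \<notin> K"
begin

sublocale K: base_subfield K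
  by unfold_locales (rule K)

lemma p_gt_1: "1 < p" and p_pos: "0 < p"
  using prime_gt_1_nat[OF p] by auto

lemma zeta_nonzero: "\<zeta> \<noteq> 0" and theta_nonzero: "\<theta> \<noteq> 0"
  using primitive_root_nonzero[OF zeta(2) p_pos] theta by auto

lemma zeta_pow: "\<zeta> ^ p = 1"
  using zeta by (simp add: primitive_root_def)

abbreviation min_poly :: "'a poly" where "min_poly \<equiv> monom 1 p - [:\<theta> ^ p:]"

lemma min_poly_eq: "min_poly = (\<Prod>j<p. [:- (\<zeta> ^ j * \<theta>), 1:])"
  using power_minus_factorization[OF zeta(2) p_pos theta_nonzero] .

lemma degree_min_poly: "degree min_poly = p" and lead_min_poly: "lead_coeff min_poly = 1"
  unfolding min_poly_eq by (subst degree_prod_eq_sum_degree; simp)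
    (subst lead_coeff_prod, simp)

lemma min_poly_over: "poly_over K min_poly"
  by (intro K.poly_over_diff K.poly_over_monom K.poly_over_pCons theta) auto

text \<open>By Bezout, \<open>\<theta>\<close> is a quotient of powers of
  \<open>\<theta> ^ n\<close> and \<open>\<theta> ^ p\<close>, so it would lie in
  \<open>K\<close>.\<close>

lemma power_theta_notin:
  assumes "0 < n" "n < p" shows "\<theta> ^ n \<notin> K"
proof
  assume n: "\<theta> ^ n \<in> K"
  obtain x y where xy: "n * x = p * y + 1" using bezout_prime[OF p assms] .
  have "(\<theta> ^ n) ^ x = (\<theta> ^ p) ^ y * \<theta>"
    by (simp flip: power_mult add: xy)
  then have "\<theta> = (\<theta> ^ n) ^ x / (\<theta> ^ p) ^ y"
    using theta_nonzero by simp
  then show False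
    using K.divide_mem[OF K.power_mem[OF n, of x] K.power_mem[OF theta(1), of y]] theta(2) by simp
qed

text \<open>Irreducibility over \<open>K\<close>: a divisor collects the linear factors indexed by
  some \<open>J\<close>; its constant term is a nonzero element of \<open>K\<close> times
  \<open>\<theta> ^ card J\<close>, which forces \<open>card J\<close> to be 0 or
  \<open>p\<close>.\<close>

lemma monic_divisor_min_poly:
  assumes D: "poly_over K D" "lead_coeff D = 1" "D dvd min_poly"
  shows "degree D = 0 \<or> D = min_poly"
proof -
  obtain J c where J: "J \<subseteq> {..<p}" and Dc: "D = smult c (\<Prod>j\<in>J. [:- (\<zeta> ^ j * \<theta>), 1:])"
    using dvd_prod_linear_factors[of "{..<p}" D "\<lambda>j. \<zeta> ^ j * \<theta>"] D(3)
    unfolding min_poly_eq by auto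
  have "c = 1" using D(2) unfolding Dc lead_coeff_smult lead_coeff_prod by simp
  with Dc have De: "D = (\<Prod>j\<in>J. [:- (\<zeta> ^ j * \<theta>), 1:])" by simp
  have deg: "degree D = card J"
    unfolding De by (subst degree_prod_eq_sum_degree) auto
  have "poly D 0 = (\<Prod>j\<in>J. - (\<zeta> ^ j)) * \<theta> ^ card J"
    unfolding De by (simp add: poly_prod prod.distrib flip: mult_minus_left)
  moreover have "(\<Prod>j\<in>J. - (\<zeta> ^ j)) \<noteq> 0"
    using zeta_nonzero finite_subset[OF J] by simp
  ultimately have "\<theta> ^ card J = poly D 0 / (\<Prod>j\<in>J. - (\<zeta> ^ j))" by simp
  also have "\<dots> \<in> K"
    by (intro K.divide_mem K.poly_mem D K.prod_mem K.uminus_mem K.power_mem zeta) simp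
  finally have "\<not> (0 < card J \<and> card J < p)" using power_theta_notin by blast
  moreover have "card J \<le> p" using card_mono[OF _ J] by simp
  ultimately consider "card J = 0" | "card J = p" by linarith
  then show ?thesis
  proof cases
    case 2
    then have "J = {..<p}" using J by (intro card_subset_eq) auto
    then show ?thesis using De min_poly_eq by simp
  qed (simp add: deg)
qed

text \<open>\<open>K[X]\<close> is principal: a monic \<open>D\<close> of least degree in the ideal
  \<open>I\<close> generated by \<open>F\<close> and \<open>min_poly\<close> divides both, and
  irreducibility leaves \<open>D = 1\<close> or \<open>D = min_poly\<close>.\<close>

lemma min_poly_dvd_or_coprime:
  assumes F: "poly_over K F"
  shows "min_poly dvd F \<or>
    (\<exists>U V. poly_over K U \<and> poly_over K V \<and> U * F + V * min_poly = 1)"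
proof -
  define I where "I = {W. \<exists>U V. poly_over K U \<and> poly_over K V \<and> W = U * F + V * min_poly}"
  have I_over: "poly_over K W" if "W \<in> I" for W
    using that by (auto simp: I_def intro!: K.poly_over_add K.poly_over_mult F min_poly_over)
  have I_diff: "W - Q * W' \<in> I" if W: "W \<in> I" "W' \<in> I" and Q: "poly_over K Q" for W W' Q
  proof -
    obtain U V U' V' where over: "poly_over K U" "poly_over K V" "poly_over K U'" "poly_over K V'"
      and eq: "W = U * F + V * min_poly" "W' = U' * F + V' * min_poly"
      using W by (auto simp: I_def)
    have "(U * F + V * P) - Q * (U' * F + V' * P) = (U - Q * U') * F + (V - Q * V') * P" for P
      by (simp add: algebra_simps)
    then have "W - Q * W' = (U - Q * U') * F + (V - Q * V') * min_poly"
      unfolding eq .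
    moreover have "poly_over K (U - Q * U')" "poly_over K (V - Q * V')"
      by (intro K.poly_over_diff K.poly_over_mult over Q)+
    ultimately show ?thesis unfolding I_def by blast
  qed
  have "min_poly \<in> I" unfolding I_def by (intro CollectI exI[of _ 0] exI[of _ 1]) auto
  have "F \<in> I" unfolding I_def by (intro CollectI exI[of _ 1] exI[of _ 0]) auto
  have "\<exists>D. (D \<in> I \<and> lead_coeff D = 1) \<and> (\<forall>E. E \<in> I \<and> lead_coeff E = 1 \<longrightarrow> degree D \<le> degree E)"
    by (rule ex_has_least_nat[of _ min_poly]) (use \<open>min_poly \<in> I\<close> lead_min_poly in blast)
  then obtain D where D: "D \<in> I" "lead_coeff D = 1"
    and least: "\<And>E. E \<in> I \<Longrightarrow> lead_coeff E = 1 \<Longrightarrow> degree D \<le> degree E" by blast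
  have dvd: "D dvd W" if W: "W \<in> I" for W
  proof -
    obtain Q S where Q: "poly_over K Q" and S: "poly_over K S"
      and eq: "W = Q * D + S" and deg: "S = 0 \<or> degree S < degree D"
      using K.division_by_monic[OF I_over[OF D(1)] D(2) I_over[OF W]] by blast
    have SI: "S \<in> I" using I_diff[OF W D(1) Q] eq by simp
    have "S = 0"
    proof (rule ccontr)
      assume "S \<noteq> 0"
      define s where "s = inverse (lead_coeff S)"
      have s: "s \<in> K" "s \<noteq> 0"
        using S \<open>S \<noteq> 0\<close> by (auto simp: s_def poly_over_def intro!: K.inverse_mem)
      \<comment> \<open>Closure of \<open>I\<close> under \<open>W - Q * W'\<close> is used with
        \<open>Q = 1 - s\<close> to reach the monic multiple \<open>s S\<close>.\<close>
      have "S - [:1 - s:] * S \<in> I"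
        by (intro I_diff SI K.poly_over_pCons K.diff_mem s) auto
      then have "smult s S \<in> I" by (simp add: smult_diff_left)
      moreover have "lead_coeff (smult s S) = 1" using \<open>S \<noteq> 0\<close> by (simp add: s_def)
      ultimately have "degree D \<le> degree (smult s S)" by (rule least)
      then show False using deg \<open>S \<noteq> 0\<close> s by simp
    qed
    then show ?thesis using eq by simp
  qed
  show ?thesis
    using monic_divisor_min_poly[OF I_over[OF D(1)] D(2) dvd[OF \<open>min_poly \<in> I\<close>]]
  proof
    assume "degree D = 0"
    then obtain d where "D = [:d:]" by (rule degree_eq_zeroE)
    then have "D = 1" using D(2) by (simp add: one_pCons)
    then show ?thesis using D(1) by (auto simp: I_def)
  qed (use dvd[OF \<open>F \<in> I\<close>] in simp)
qed

lemma root_theta_imp_dvd: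
  assumes "poly_over K F" "poly F \<theta> = 0"
  shows "min_poly dvd F"
proof (rule ccontr)
  assume "\<not> min_poly dvd F"
  then obtain U V where "U * F + V * min_poly = 1"
    using min_poly_dvd_or_coprime[OF assms(1)] by blast
  then have "poly (U * F + V * min_poly) \<theta> = 1" by simp
  then show False using assms(2) by (simp add: poly_monom)
qed

lemma root_theta_imp_zero:
  assumes "poly_over K F" "poly F \<theta> = 0" "degree F < p"
  shows "F = 0"
  using dvd_imp_degree_le[OF root_theta_imp_dvd[OF assms(1,2)]] assms(3)
  unfolding degree_min_poly by auto

text \<open>This stands in for the automorphism over \<open>K\<close> sending
  \<open>\<theta>\<close> to \<open>\<zeta> * \<theta>\<close>: both are roots of
  \<open>min_poly\<close>, which divides \<open>F\<close>.\<close>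

lemma root_conjugate:
  assumes "poly_over K F" "poly F \<theta> = 0"
  shows "poly F (\<zeta> * \<theta>) = 0"
  using root_theta_imp_dvd[OF assms] zeta_pow
  by (auto elim!: dvdE simp: poly_monom power_mult_distrib)

text \<open>\<open>K[\<theta>]\<close> is already a field: evaluating
  \<open>U * F + V * min_poly = 1\<close> at \<open>\<theta>\<close> turns \<open>U\<close> into an
  inverse.\<close>

lemma subfield_polys: "subfield {poly F \<theta> |F. poly_over K F}"
  unfolding subfield_def
proof (intro conjI ballI)
  let ?E = "{poly F \<theta> |F. poly_over K F}"
  show "0 \<in> ?E" by (rule CollectI, rule exI[of _ 0]) simp
  show "1 \<in> ?E" by (rule CollectI, rule exI[of _ 1]) simp
  fix x assume "x \<in> ?E"
  then obtain F where F: "poly_over K F" "x = poly F \<theta>" by blast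
  show "inverse x \<in> ?E"
  proof (cases "min_poly dvd F")
    case True
    then have "x = 0" using F(2) by (auto elim!: dvdE simp: poly_monom)
    then show ?thesis using \<open>0 \<in> ?E\<close> by simp
  next
    case False
    then obtain U V where U: "poly_over K U" "U * F + V * min_poly = 1"
      using min_poly_dvd_or_coprime[OF F(1)] by blast
    then have "poly (U * F + V * min_poly) \<theta> = 1" by simp
    then have "poly U \<theta> * x = 1" using F by (simp add: poly_monom)
    then have "inverse x = poly U \<theta>" by (metis inverse_unique mult.commute)
    then show ?thesis using U by blast
  qed
  fix y assume "y \<in> ?E"
  then obtain G where G: "poly_over K G" "y = poly G \<theta>" by blast
  show "x + y \<in> ?E" using F G by (intro CollectI exI[of _ "F + G"]) (simp add: K.poly_over_add)
  show "x - y \<in> ?E" using F G by (intro CollectI exI[of _ "F - G"]) (simp add: K.poly_over_diff)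
  show "x * y \<in> ?E" using F G by (intro CollectI exI[of _ "F * G"]) (simp add: K.poly_over_mult)
qed

end

text \<open>\<open>\<theta>\<close> stays a parameter because the results are applied later with
  elements of \<open>S\<close> in its place.\<close>

locale kummer_extension = kummer_root +
  assumes gen: "generates K {\<theta>}"
begin

lemma ex_poly:
  obtains F where "poly_over K F" "degree F < p" "x = poly F \<theta>"
proof -
  let ?E = "{poly F \<theta> |F. poly_over K F}"
  have "K \<subseteq> ?E"
  proof
    fix c assume "c \<in> K"
    then show "c \<in> ?E" by (intro CollectI exI[of _ "[:c:]"]) (simp add: K.poly_over_pCons)
  qed
  moreover have "\<theta> \<in> ?E"
    by (intro CollectI exI[of _ "[:0, 1:]"]) (simp add: K.poly_over_pCons)
  ultimately have "?E = UNIV"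
    using gen subfield_polys unfolding generates_def by blast
  then have "x \<in> ?E" by simp
  then obtain G where G: "poly_over K G" "x = poly G \<theta>" by blast
  obtain Q S where S: "poly_over K S" "G = Q * min_poly + S" "S = 0 \<or> degree S < p"
    using K.division_by_monic[OF min_poly_over lead_min_poly G(1)] by (auto simp: degree_min_poly)
  then show ?thesis using G p_pos by (intro that[of S]) (auto simp: poly_monom)
qed

lemma pth_root_of_unity:
  assumes "x ^ p = 1" obtains j where "j < p" "x = \<zeta> ^ j"
proof -
  have "poly (monom 1 p - [:1 ^ p:]) x = 0" using assms by (simp add: poly_monom)
  then have "(\<Prod>j<p. x - \<zeta> ^ j) = 0"
    unfolding power_minus_factorization[OF zeta(2) p_pos one_neq_zero]
    by (simp add: poly_prod)
  then show ?thesis using that by (auto simp: prod_zero_iff)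
qed

text \<open>If \<open>\<alpha> = F(\<theta>)\<close> with \<open>\<alpha>^p \<in> K\<close>, then \<open>F(\<zeta> \<theta>) = \<zeta>^j \<alpha>\<close> for some \<open>j\<close>, and comparing
  coefficients of \<open>F(\<zeta> X)\<close> and \<open>\<zeta>^j F(X)\<close> leaves only the monomial of degree \<open>j\<close>.\<close>
lemma pth_root_in_K:
  assumes a: "\<alpha> ^ p \<in> K"
  obtains c j where "c \<in> K" "j < p" "\<alpha> = c * \<theta> ^ j"
proof (cases "\<alpha> = 0")
  case True
  then show ?thesis using that[of 0 0] p_pos by simp
next
  case False
  obtain F where F: "poly_over K F" "degree F < p" "\<alpha> = poly F \<theta>" by (rule ex_poly)
  \<comment> \<open>\<open>F ^ p - \<alpha> ^ p\<close> vanishes at \<open>\<theta>\<close>, hence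
    at its conjugate, so \<open>F(\<zeta> \<theta>)\<close> and \<open>\<alpha>\<close> differ by a
    \<open>p\<close>-th root of unity.\<close>
  have "poly (F ^ p - [:\<alpha> ^ p:]) (\<zeta> * \<theta>) = 0"
    by (intro root_conjugate K.poly_over_diff K.poly_over_power K.poly_over_pCons F a)
      (auto simp: F(3))
  then have "(poly F (\<zeta> * \<theta>) / \<alpha>) ^ p = 1"
    using False by (simp add: power_divide)
  then obtain j where j: "j < p" "poly F (\<zeta> * \<theta>) / \<alpha> = \<zeta> ^ j"
    by (rule pth_root_of_unity)
  define G where "G = pcompose F [:0, \<zeta>:] - smult (\<zeta> ^ j) F"
  have "G = 0"
  proof (rule root_theta_imp_zero)
    show "poly_over K G" unfolding G_def
      by (intro K.poly_over_diff K.poly_over_smult K.poly_over_pcompose K.poly_over_pCons F K.power_mem zeta) auto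
    show "poly G \<theta> = 0"
      using j False F(3) by (simp add: G_def poly_pcompose field_simps)
    have "degree (pcompose F [:0, \<zeta>:]) \<le> degree F"
      by (rule order.trans[OF degree_pcompose_le]) simp
    moreover have "degree (smult (\<zeta> ^ j) F) \<le> degree F" by (rule degree_smult_le)
    ultimately show "degree G < p" unfolding G_def
      using F(2) degree_diff_le_max[of "pcompose F [:0, \<zeta>:]" "smult (\<zeta> ^ j) F"] by linarith
  qed
  have zero: "coeff F i = 0" if "i \<noteq> j" for i
  proof (cases "i < p")
    case True
    have "coeff G i = (\<zeta> ^ i - \<zeta> ^ j) * coeff F i"
      by (simp add: G_def coeff_pcompose_linear algebra_simps)
    moreover have "\<zeta> ^ i \<noteq> \<zeta> ^ j"
      using primitive_root_inj[OF zeta(2) True j(1) _ zeta_nonzero] that by blast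
    ultimately show ?thesis using \<open>G = 0\<close> by simp
  next
    case False
    then show ?thesis using F(2) by (intro coeff_eq_0) simp
  qed
  have "F = monom (coeff F j) j"
    by (rule poly_eqI) (auto simp: zero)
  then have "\<alpha> = coeff F j * \<theta> ^ j" using F(3) poly_monom[of "coeff F j" j \<theta>] by simp
  then show ?thesis using that[of "coeff F j" j] F(1) j(1) by (auto simp: poly_over_def)
qed

end

section \<open>Valuations and immediate extensions\<close>

lemma poly_split_linear:
  fixes G :: "'a::comm_ring_1 poly"
  shows "poly G x = coeff G 0 + coeff G 1 * x + (\<Sum>k\<in>{2..degree G}. coeff G k * x ^ k)"
proof (cases "degree G")
  case 0
  then show ?thesis by (auto elim: degree_eq_zeroE)
next
  case (Suc m)
  then have "{..degree G} = insert 0 (insert 1 {2..degree G})" by auto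
  then show ?thesis unfolding poly_altdef by (simp add: add.assoc)
qed

locale valued_field =
  fixes OL :: "'a::field set"
  assumes OL: "valuation_ring UNIV OL"
begin

sublocale V: base_subring OL
  using OL by unfold_locales (simp add: valuation_ring_def)

text \<open>\<open>x \<preceq> y\<close> is the relation \<open>v(x) \<ge> v(y)\<close>, so that it reads like an inequality of absolute values.\<close>
definition vle :: "'a \<Rightarrow> 'a \<Rightarrow> bool" (infix "\<preceq>" 50) where
  "x \<preceq> y \<longleftrightarrow> (\<exists>r\<in>OL. x = r * y)"

definition vlt :: "'a \<Rightarrow> 'a \<Rightarrow> bool" (infix "\<prec>" 50) where
  "x \<prec> y \<longleftrightarrow> \<not> y \<preceq> x"

lemma vle_refl [simp]: "x \<preceq> x"
  unfolding vle_def by (intro bexI[of _ 1]) auto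

lemma vle_trans: "x \<preceq> y \<Longrightarrow> y \<preceq> z \<Longrightarrow> x \<preceq> z"
  unfolding vle_def by (metis V.mult_mem mult.assoc)

lemma vle_total: "x \<preceq> y \<or> y \<preceq> x"
proof (cases "x = 0 \<or> y = 0")
  case True
  then show ?thesis unfolding vle_def by (metis V.zero_mem mult_zero_left)
next
  case False
  then have "x / y \<in> OL \<or> y / x \<in> OL"
    using OL unfolding valuation_ring_def
    by (metis UNIV_I divide_eq_0_iff inverse_divide)
  moreover have "x = x / y * y" "y = y / x * x" using False by auto
  ultimately show ?thesis unfolding vle_def by blast
qed

lemma vlt_imp_vle: "x \<prec> y \<Longrightarrow> x \<preceq> y"
  using vle_total vlt_def by blast

lemma vlt_irrefl [simp]: "\<not> x \<prec> x"
  by (simp add: vlt_def)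

lemma vle_vlt_trans: "x \<preceq> y \<Longrightarrow> y \<prec> z \<Longrightarrow> x \<prec> z"
  and vlt_vle_trans: "x \<prec> y \<Longrightarrow> y \<preceq> z \<Longrightarrow> x \<prec> z"
  unfolding vlt_def by (blast intro: vle_trans)+

lemma zero_vle [simp]: "0 \<preceq> x"
  unfolding vle_def by (intro bexI[of _ 0]) auto

lemma vle_zero [simp]: "x \<preceq> 0 \<longleftrightarrow> x = 0"
  unfolding vle_def using V.zero_mem by (auto simp del: V.zero_mem)

lemma zero_vlt [simp]: "0 \<prec> x \<longleftrightarrow> x \<noteq> 0"
  by (simp add: vlt_def)

lemma vlt_nonzero: "x \<prec> y \<Longrightarrow> y \<noteq> 0"
  by (auto simp: vlt_def)

lemma mem_iff_vle: "x \<in> OL \<longleftrightarrow> x \<preceq> 1"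
  by (auto simp: vle_def)

lemma vle_mult_right: "x \<preceq> y \<Longrightarrow> x * z \<preceq> y * z"
  unfolding vle_def by (auto simp: mult.assoc)

lemma vle_mult: "x \<preceq> y \<Longrightarrow> u \<preceq> w \<Longrightarrow> x * u \<preceq> y * w"
  using vle_trans[OF vle_mult_right[of x y u]] vle_mult_right[of u w y] by (simp add: mult.commute)

lemma vle_mult_cancel [simp]: "z \<noteq> 0 \<Longrightarrow> x * z \<preceq> y * z \<longleftrightarrow> x \<preceq> y"
  using vle_mult_right[of "x * z" "y * z" "inverse z"] vle_mult_right[of x y z]
  by (auto simp: mult.assoc)

lemma vlt_mult_cancel [simp]: "z \<noteq> 0 \<Longrightarrow> x * z \<prec> y * z \<longleftrightarrow> x \<prec> y"
  by (simp add: vlt_def)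

lemma vlt_mult: "x \<prec> y \<Longrightarrow> u \<preceq> w \<Longrightarrow> w \<noteq> 0 \<Longrightarrow> x * u \<prec> y * w"
  using vle_vlt_trans[OF vle_mult[OF vle_refl[of x]]] by simp

lemma vle_power: "x \<preceq> y \<Longrightarrow> x ^ n \<preceq> y ^ n"
  by (induction n) (auto intro: vle_mult)

lemma vle_one_mult: "x \<preceq> 1 \<Longrightarrow> y \<preceq> z \<Longrightarrow> x * y \<preceq> z"
  using vle_mult[of x 1 y z] by simp

lemma divide_vle_one: "y \<noteq> 0 \<Longrightarrow> x / y \<preceq> 1 \<longleftrightarrow> x \<preceq> y"
  using vle_mult_cancel[of y "x / y" 1] by simp

lemma one_vle_divide: "y \<noteq> 0 \<Longrightarrow> 1 \<preceq> x / y \<longleftrightarrow> y \<preceq> x"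
  using vle_mult_cancel[of y 1 "x / y"] by simp

lemma divide_vlt_one: "y \<noteq> 0 \<Longrightarrow> x / y \<prec> 1 \<longleftrightarrow> x \<prec> y"
  by (simp add: vlt_def one_vle_divide)

lemma vle_add: "x \<preceq> z \<Longrightarrow> y \<preceq> z \<Longrightarrow> x + y \<preceq> z"
  unfolding vle_def by (metis V.add_mem distrib_right)

lemma vlt_add: "x \<prec> z \<Longrightarrow> y \<prec> z \<Longrightarrow> x + y \<prec> z"
  using vle_total[of x y] vle_add[of x y y] vle_add[of x x y] vle_vlt_trans by auto

lemma vle_uminus [simp]: "- x \<preceq> y \<longleftrightarrow> x \<preceq> y" "x \<preceq> - y \<longleftrightarrow> x \<preceq> y"
proof -
  have *: "- x \<preceq> y" if "x \<preceq> y" for x y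
    using that V.uminus_mem unfolding vle_def by (metis mult_minus_left)
  have **: "x \<preceq> - y" if "x \<preceq> y" for x y
    using that V.uminus_mem unfolding vle_def by (metis minus_mult_minus)
  show "- x \<preceq> y \<longleftrightarrow> x \<preceq> y"
    using *[of "- x" y] *[of x y] unfolding minus_minus by (rule iffI)
  show "x \<preceq> - y \<longleftrightarrow> x \<preceq> y"
    using **[of x "- y"] **[of x y] unfolding minus_minus by (rule iffI)
qed

lemma vlt_uminus [simp]: "- x \<prec> y \<longleftrightarrow> x \<prec> y" "x \<prec> - y \<longleftrightarrow> x \<prec> y"
  by (simp_all add: vlt_def)

lemma vle_diff: "x \<preceq> z \<Longrightarrow> y \<preceq> z \<Longrightarrow> x - y \<preceq> z"
  using vle_add[of x z "- y"] by simp

lemma vlt_diff: "x \<prec> z \<Longrightarrow> y \<prec> z \<Longrightarrow> x - y \<prec> z"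
  using vlt_add[of x z "- y"] by simp

lemma vle_minus_commute: "x - y \<preceq> z \<longleftrightarrow> y - x \<preceq> z" "z \<preceq> x - y \<longleftrightarrow> z \<preceq> y - x"
  using vle_uminus(1)[of "x - y"] vle_uminus(2)[of z "x - y"] by simp_all

lemma vlt_sum: "z \<noteq> 0 \<Longrightarrow> (\<And>i. i \<in> I \<Longrightarrow> f i \<prec> z) \<Longrightarrow> sum f I \<prec> z"
  by (induction I rule: infinite_finite_induct) (auto intro: vlt_add)

text \<open>If \<open>y\<close> were strictly smaller than \<open>x\<close>, then
  \<open>x = (x - y) + y\<close> would be strictly smaller than itself.\<close>

lemma vle_of_diff_vlt: "x - y \<prec> x \<Longrightarrow> x \<preceq> y"
  using vlt_add[of "x - y" x y] by (auto simp: vlt_def)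

lemma max_ideal_iff: "x \<in> max_ideal OL \<longleftrightarrow> x \<prec> 1"
proof (cases "x = 0")
  case False
  have "inverse x \<in> OL \<longleftrightarrow> 1 \<preceq> x"
    using False by (simp add: mem_iff_vle inverse_eq_divide divide_vle_one)
  then show ?thesis using False vlt_imp_vle[of x 1]
    by (auto simp: max_ideal_def ring_units_def vlt_def mem_iff_vle)
qed (auto simp: max_ideal_def ring_units_def)

lemma ring_units_iff: "x \<in> ring_units OL \<longleftrightarrow> x \<preceq> 1 \<and> 1 \<preceq> x"
proof (cases "x = 0")
  case False
  then show ?thesis
    by (simp add: ring_units_def mem_iff_vle inverse_eq_divide divide_vle_one)
qed (simp add: ring_units_def)

text \<open>These are the polynomials with zero reduction modulo the maximal ideal of
  \<open>OL\<close>.\<close>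

definition poly_vlt_one :: "'a poly \<Rightarrow> bool" where
  "poly_vlt_one f \<longleftrightarrow> (\<forall>i. coeff f i \<prec> 1)"

lemma poly_vlt_one_add: "poly_vlt_one f \<Longrightarrow> poly_vlt_one g \<Longrightarrow> poly_vlt_one (f + g)"
  by (simp add: poly_vlt_one_def vlt_add)

lemma poly_vlt_one_mult: "poly_over OL g \<Longrightarrow> poly_vlt_one f \<Longrightarrow> poly_vlt_one (g * f)"
  unfolding poly_vlt_one_def poly_over_def coeff_mult mem_iff_vle
  using vlt_mult[of _ 1 _ 1] by (auto intro!: vlt_sum simp: mult.commute[of "coeff g _"])

lemma poly_vlt_one_pcompose: "poly_vlt_one f \<Longrightarrow> poly_over OL g \<Longrightarrow> poly_vlt_one (pcompose f g)"
proof (induction f)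
  case 0
  then show ?case by (simp add: poly_vlt_one_def)
next
  case (pCons a f)
  have a: "poly_vlt_one [:a:]" and f: "poly_vlt_one f"
    using pCons.prems(1)[unfolded poly_vlt_one_def, THEN spec, of 0]
      pCons.prems(1)[unfolded poly_vlt_one_def, THEN spec, of "Suc _"]
    by (auto simp: poly_vlt_one_def coeff_pCons split: nat.split)
  then show ?case
    using pCons by (simp add: pcompose_pCons poly_vlt_one_add poly_vlt_one_mult)
qed

lemma poly_vlt_one_poly: 
  assumes "poly_vlt_one f" "x \<preceq> 1" shows "poly f x \<prec> 1"
  unfolding poly_altdef
proof (rule vlt_sum)
  fix i
  show "coeff f i * x ^ i \<prec> 1"
    using vlt_mult[of "coeff f i" 1 "x ^ i" 1] vle_power[OF assms(2), of i] assms(1)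
    by (simp add: poly_vlt_one_def)
qed simp

lemma poly_vlt_one_pderiv: "poly_vlt_one f \<Longrightarrow> poly_vlt_one (pderiv f)"
  using vlt_mult[of _ 1 "of_nat _" 1] V.of_nat_mem
  by (auto simp: poly_vlt_one_def coeff_pderiv mem_iff_vle mult.commute[of "of_nat _"]
    simp del: of_nat_Suc)

lemma one_vlt_power:
  assumes "1 \<prec> x" "0 < n" shows "1 \<prec> x ^ n"
proof -
  have "1 \<prec> x ^ Suc m" for m
  proof (induction m)
    case (Suc m)
    have "1 * 1 \<prec> x * x ^ Suc m"
      using vlt_mult[OF assms(1) vlt_imp_vle[OF Suc] vlt_nonzero[OF Suc]] .
    then show ?case by simp
  qed (use assms in simp)
  then show ?thesis using assms(2) by (metis Suc_pred)
qed

lemma one_vle_prod: "(\<And>i. i \<in> I \<Longrightarrow> 1 \<preceq> f i) \<Longrightarrow> 1 \<preceq> prod f I"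
proof (induction I rule: infinite_finite_induct)
  case (insert i I)
  then have "1 * 1 \<preceq> f i * prod f I" by (intro vle_mult) auto
  then show ?case using insert by simp
qed auto

lemma unit_if_power_unit:
  assumes "x ^ n \<preceq> 1" "1 \<preceq> x ^ n" "0 < n"
  shows "x \<preceq> 1" "1 \<preceq> x"
proof -
  show "x \<preceq> 1"
    using one_vlt_power[of x n] assms unfolding vlt_def by blast
  have "x \<noteq> 0" using assms by (auto simp: power_0_left)
  then have "\<not> 1 \<prec> 1 / x"
    using one_vlt_power[of "1 / x" n] assms
    by (auto simp: power_divide vlt_def divide_vle_one)
  then show "1 \<preceq> x"
    using \<open>x \<noteq> 0\<close> by (simp add: vlt_def divide_vle_one)
qed

text \<open>Valuation rings are integrally closed: for \<open>x\<close> outside \<open>OL\<close>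
  the leading term \<open>x ^ n\<close> of a monic equation would strictly dominate all
  others.\<close>

lemma integral_closure_subset:
  assumes "R \<subseteq> OL" shows "integral_closure R \<subseteq> OL"
proof
  fix x assume "x \<in> integral_closure R"
  then obtain f where f: "poly_over R f" "lead_coeff f = 1" "poly f x = 0"
    by (auto simp: integral_closure_def)
  define n where "n = degree f"
  show "x \<in> OL"
  proof (rule ccontr)
    assume "x \<notin> OL"
    then have x: "1 \<prec> x" by (simp add: mem_iff_vle vlt_def)
    then have x0: "x \<noteq> 0" by (rule vlt_nonzero)
    have "(\<Sum>i<n. coeff f i * x ^ i) \<prec> x ^ n"
    proof (rule vlt_sum)
      fix i assume "i \<in> {..<n}"
      then have "1 \<prec> x ^ (n - i)" and split: "x ^ (n - i) * x ^ i = x ^ n"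
        using x by (auto intro: one_vlt_power simp flip: power_add)
      then have "1 * x ^ i \<prec> x ^ n"
        unfolding split[symmetric] using x0 by (intro vlt_mult) auto
      moreover have "coeff f i * x ^ i \<preceq> x ^ i"
        using f(1) assms by (intro vle_one_mult) (auto simp: poly_over_def mem_iff_vle)
      ultimately show "coeff f i * x ^ i \<prec> x ^ n" using vle_vlt_trans by simp
    qed (use x0 in simp)
    moreover have "poly f x = (\<Sum>i<n. coeff f i * x ^ i) + x ^ n"
      unfolding poly_altdef n_def[symmetric] using f(2)
      by (simp add: n_def flip: lessThan_Suc_atMost)
    then have "x ^ n = - (\<Sum>i<n. coeff f i * x ^ i)"
      using f(3) by (simp add: eq_neg_iff_add_eq_0 add.commute)
    ultimately show False by (metis vlt_irrefl vlt_uminus(1))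
  qed
qed

end

section \<open>Immediate extensions of henselian fields: approximation and Hensel's lemma\<close>

locale immediate_extension = valued_field OL
  for OL :: "'a::field_char_0 set" +
  fixes K A :: "'a set" and p :: nat
  assumes K: "subfield K" and A: "valuation_ring K A" and hensel: "henselian A"
    and p: "prime p" and p_max: "of_nat p \<in> max_ideal A"
    and OL_K: "OL \<inter> K = A"
    and ram: "ram_index_one K OL" and res: "res_degree_one A OL"
begin

sublocale K: base_subfield K
  by unfold_locales (rule K)

sublocale A: base_subring A
  by unfold_locales (use A in \<open>simp add: valuation_ring_def\<close>)

lemma mem_A_iff: "x \<in> A \<longleftrightarrow> x \<in> K \<and> x \<preceq> 1"
  using OL_K by (auto simp: mem_iff_vle)

lemma max_ideal_A_iff: "x \<in> max_ideal A \<longleftrightarrow> x \<in> K \<and> x \<prec> 1"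
  and ring_units_A_iff: "x \<in> ring_units A \<longleftrightarrow> x \<in> K \<and> x \<preceq> 1 \<and> 1 \<preceq> x"
  using max_ideal_iff[of x] ring_units_iff[of x] OL_K K.inverse_mem[of x]
  by (auto simp: max_ideal_def ring_units_def)

lemma poly_over_A_iff: "poly_over A f \<longleftrightarrow> poly_over K f \<and> poly_over OL f"
  using OL_K by (auto simp: poly_over_def)

lemma ex_same_value:
  assumes "x \<noteq> 0" obtains c where "c \<in> K" "c \<noteq> 0" "c \<preceq> x" "x \<preceq> c"
  using ram assms unfolding ram_index_one_def ring_units_iff
  by (metis divide_vle_one one_vle_divide)

text \<open>Ramification index 1 supplies \<open>c\<close> of the value of \<open>x\<close>, residue
  degree 1 an \<open>a\<close> with the residue of \<open>x / c\<close>; then \<open>a * c\<close>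
  agrees with \<open>x\<close> to leading order.\<close>

lemma ex_closer:
  assumes "x \<noteq> 0" obtains c where "c \<in> K" "x - c \<prec> x"
proof -
  obtain c where c: "c \<in> K" "c \<noteq> 0" "c \<preceq> x" "x \<preceq> c" using ex_same_value[OF assms] .
  then have "x / c \<in> OL" by (simp add: mem_iff_vle divide_vle_one)
  then obtain a where a: "a \<in> A" "x / c - a \<prec> 1"
    using res unfolding res_degree_one_def max_ideal_iff by blast
  have "(x / c - a) * c \<prec> 1 * c" by (rule iffD2[OF vlt_mult_cancel[OF c(2)] a(2)])
  then have "x - a * c \<prec> c" using c by (simp add: algebra_simps)
  then show ?thesis using that[of "a * c"] a c vlt_vle_trans
    by (auto simp: mem_A_iff intro: K.mult_mem)
qed

lemma ex_better_approx:
  assumes "x \<notin> K" "c \<in> K" obtains c' where "c' \<in> K" "x - c' \<prec> x - c"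
proof -
  obtain d where "d \<in> K" "x - c - d \<prec> x - c"
    using ex_closer[of "x - c"] assms by auto
  then show ?thesis using that[of "c + d"] assms by (auto simp: diff_diff_eq intro: K.add_mem)
qed

text \<open>A relation \<open>i * x - p * y = 1\<close> keeps \<open>i\<close> and \<open>p\<close>
  from both being in the maximal ideal. This serves to cancel the integer factors that
  differentiation introduces.\<close>

lemma of_nat_unit:
  assumes "0 < i" "i < p" shows "1 \<preceq> of_nat i"
proof (rule ccontr)
  assume "\<not> 1 \<preceq> of_nat i"
  then have i: "of_nat i \<prec> 1" by (simp add: vlt_def)
  have pv: "of_nat p \<prec> 1" using p_max by (simp add: max_ideal_A_iff)
  have ofn: "of_nat n \<preceq> 1" for n using V.of_nat_mem by (simp add: mem_iff_vle)
  obtain x y where xy: "i * x = p * y + 1" using bezout_prime[OF p assms] .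
  have "(of_nat i * of_nat x :: 'a) = of_nat p * of_nat y + 1"
    using arg_cong[OF xy, of "of_nat :: nat \<Rightarrow> 'a"] by simp
  then have "1 = (of_nat i * of_nat x - of_nat p * of_nat y :: 'a)" by simp
  moreover have "of_nat i * of_nat x - of_nat p * of_nat y \<prec> 1"
    using vlt_mult[OF i ofn] vlt_mult[OF pv ofn] by (intro vlt_diff) auto
  ultimately show False by (metis vlt_irrefl)
qed

text \<open>After division by the linear coefficient and the substitution \<open>X = r\<^sub>0 / Z\<close> the polynomial becomes
  the monic \<open>Z^(n+2) + Z^(n+1) + \<Sum> r\<^sub>i r\<^sub>0^(i-1) Z^(n+2-i)\<close>, which has the simple residual root \<open>-1\<close>.\<close>
lemma hensel_linear:
  assumes r: "poly_over A r" and r1: "1 \<preceq> coeff r 1" and r2: "\<And>i. i \<ge> 2 \<Longrightarrow> coeff r i \<prec> 1"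
  obtains x where "x \<in> A" "poly r x = 0"
proof -
  define s where "s = smult (1 / coeff r 1) r"
  have r1K: "coeff r 1 \<in> K" and r1_0: "coeff r 1 \<noteq> 0"
    using r r1 by (auto simp: poly_over_def mem_A_iff)
  have inv: "1 / coeff r 1 \<in> A"
    using r1K r1_0 r1 by (simp add: mem_A_iff K.divide_mem divide_vle_one)
  have s: "poly_over A s" unfolding s_def by (intro A.poly_over_smult inv r)
  have s1: "coeff s 1 = 1" using r1_0 by (simp add: s_def)
  have s2: "coeff s i \<prec> 1" if "i \<ge> 2" for i
    using vlt_mult[OF r2[OF that], of "1 / coeff r 1" 1] inv by (simp add: s_def mem_A_iff)
  have roots: "poly r x = 0" if "poly s x = 0" for x
    using that r1_0 by (simp add: s_def)
  define r0 where "r0 = coeff s 0"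
  have r0: "r0 \<in> K" "r0 \<preceq> 1" using s by (auto simp: r0_def poly_over_def mem_A_iff)
  define n where "n = degree s"
  \<comment> \<open>Every exponent in \<open>W\<close> lies between 2 and \<open>n\<close>, so the
    two leading monomials of \<open>Q\<close> stand apart from it.\<close>
  define W where "W = (\<Sum>i\<in>{2..n}. monom (coeff s i * r0 ^ (i - 1)) (n + 2 - i))"
  define Q where "Q = monom 1 (n + 2) + monom 1 (n + 1) + W"
  have W: "poly_over A W" unfolding W_def
    using s by (intro A.poly_over_sum A.poly_over_monom A.mult_mem A.power_mem)
      (auto simp: mem_A_iff r0 poly_over_def)
  have Wm: "poly_vlt_one W"
    unfolding poly_vlt_one_def W_def coeff_sum
  proof (intro allI vlt_sum)
    fix k i assume "i \<in> {2..n}"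
    then have "coeff s i * r0 ^ (i - 1) \<prec> 1"
      using vlt_mult[OF s2[of i], of "r0 ^ (i - 1)" 1] vle_power[OF r0(2), of "i - 1"] by simp
    then show "coeff (monom (coeff s i * r0 ^ (i - 1)) (n + 2 - i)) k \<prec> 1" by simp
  qed simp
  have degW: "degree W \<le> n" unfolding W_def
    by (intro degree_sum_le) (auto intro: order.trans[OF degree_monom_le])
  have Q: "poly_over A Q" unfolding Q_def
    by (intro A.poly_over_add A.poly_over_monom W) auto
  have "coeff Q (n + 2) = 1" using degW by (simp add: Q_def coeff_eq_0)
  moreover have "degree Q \<le> n + 2" unfolding Q_def
    by (intro degree_add_le order.trans[OF degree_monom_le] order.trans[OF degW]) auto
  ultimately have lead: "lead_coeff Q = 1"
    by (metis le_antisym le_degree zero_neq_one)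
  have minus1: "- 1 \<in> A" using A.uminus_mem[of 1] by simp
  have "poly Q (- 1) = poly W (- 1)" by (simp add: Q_def poly_monom)
  then have Qroot: "poly Q (- 1) \<in> max_ideal A"
    using poly_vlt_one_poly[OF Wm, of "- 1"] A.poly_mem[OF W minus1]
    by (simp add: max_ideal_A_iff mem_A_iff)
  \<comment> \<open>The factors \<open>n + 2\<close> and \<open>n + 1\<close> of the two leading
    terms combine to a sign, so the residual root is simple whatever \<open>n\<close> is modulo
    \<open>p\<close>.\<close>
  have dQ: "poly (pderiv Q) (- 1) = - ((- 1) ^ n) + poly (pderiv W) (- 1)"
    by (simp add: Q_def pderiv_add pderiv_monom poly_monom algebra_simps)
  have dW: "poly (pderiv W) (- 1) \<prec> 1"
    by (intro poly_vlt_one_poly poly_vlt_one_pderiv Wm) simp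
  have sg: "(- 1) ^ n \<preceq> (1 :: 'a)" "1 \<preceq> ((- 1) ^ n :: 'a)"
    by (cases "even n"; simp)+
  have "1 \<preceq> poly (pderiv Q) (- 1)"
  proof (rule ccontr)
    assume "\<not> 1 \<preceq> poly (pderiv Q) (- 1)"
    then have "poly (pderiv W) (- 1) - poly (pderiv Q) (- 1) \<prec> 1"
      by (intro vlt_diff dW) (simp add: vlt_def)
    then show False using sg(2) by (simp add: dQ vlt_def)
  qed
  moreover have "poly (pderiv Q) (- 1) \<in> A"
    by (intro A.poly_mem A.poly_over_pderiv Q minus1)
  ultimately have "poly (pderiv Q) (- 1) \<in> ring_units A"
    by (simp add: ring_units_A_iff mem_A_iff)
  then obtain b where b: "b \<in> A" "poly Q b = 0" "b - (- 1) \<in> max_ideal A"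
    using hensel Q lead minus1 Qroot unfolding henselian_def by blast
  have "- 1 - b = - (b - (- 1))" by simp
  then have "- 1 - b \<prec> - 1" using b(3) by (simp only: max_ideal_A_iff vlt_uminus)
  then have "1 \<preceq> b" using vle_of_diff_vlt[of "- 1" b] by simp
  then have b0: "b \<noteq> 0" by auto
  have x: "r0 / b \<in> A"
  proof -
    have "r0 / b \<preceq> 1"
      using vle_trans[OF r0(2) \<open>1 \<preceq> b\<close>] by (simp add: divide_vle_one[OF b0])
    then show ?thesis using b r0 by (auto simp: mem_A_iff intro: K.divide_mem)
  qed
  have n1: "n \<ge> 1" unfolding n_def using s1 by (metis le_degree zero_neq_one)
  have term_eq: "b ^ (n + 2) * (coeff s i * (r0 / b) ^ i) = r0 * poly (monom (coeff s i * r0 ^ (i - 1)) (n + 2 - i)) b"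
    if "i \<in> {2..n}" for i
  proof -
    have "b ^ (n + 2) = b ^ i * b ^ (n + 2 - i)" "r0 ^ i = r0 * r0 ^ (i - 1)"
      using that by (simp_all flip: power_add power_Suc)
    then show ?thesis using b0 by (simp add: poly_monom power_divide)
  qed
  have "b ^ (n + 2) * poly s (r0 / b) =
      b ^ (n + 2) * (r0 + r0 / b) + (\<Sum>i\<in>{2..n}. b ^ (n + 2) * (coeff s i * (r0 / b) ^ i))"
    unfolding poly_split_linear[of s] n_def[symmetric]
    by (simp only: s1 r0_def distrib_left sum_distrib_left mult_1_left add.assoc)
  also have "(\<Sum>i\<in>{2..n}. b ^ (n + 2) * (coeff s i * (r0 / b) ^ i)) = r0 * poly W b"
    unfolding W_def poly_sum sum_distrib_left by (rule sum.cong[OF refl term_eq])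
  also have "b ^ (n + 2) * (r0 + r0 / b) + r0 * poly W b = r0 * poly Q b"
    using b0 by (simp add: Q_def poly_monom field_simps)
  finally have "poly s (r0 / b) = 0" using b b0 by simp
  then show ?thesis using that[OF x] roots by blast
qed

text \<open>\<open>G\<close> is the Taylor expansion of \<open>F\<close> at \<open>x\<close>.
  Rescaling by elements of \<open>K\<close> with the values of \<open>x - c\<close> and of the
  linear term gives a polynomial that is linear modulo the maximal ideal, so
  \<open>hensel_linear\<close> applies.\<close>

lemma ex_root_near:
  assumes F: "poly_over K F" and c: "c \<in> K" "x \<noteq> c"
    and G_def: "G = pcompose F [:x, 1:]"
    and G1: "coeff G 1 \<noteq> 0"
    and dom: "\<And>m. m \<ge> 1 \<Longrightarrow> coeff G (Suc m) * (x - c) ^ m \<prec> coeff G 1"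
    and G0: "coeff G 0 \<preceq> coeff G 1 * (x - c)"
  obtains b where "b \<in> K" "x - b \<preceq> x - c" "poly F b = 0"
proof -
  obtain e where e: "e \<in> K" "e \<noteq> 0" "e \<preceq> x - c" "x - c \<preceq> e"
    using ex_same_value[of "x - c"] c by auto
  obtain k where k: "k \<in> K" "k \<noteq> 0" "k \<preceq> coeff G 1 * e" "coeff G 1 * e \<preceq> k"
    using ex_same_value[of "coeff G 1 * e"] G1 e by auto
  define s where "s = (c - x) / e"
  have s: "s \<preceq> 1" using e(4) by (simp add: s_def divide_vle_one[OF e(2)] vle_minus_commute(1)[of c])
  \<comment> \<open>\<open>r\<close>, the rescaled expansion at \<open>c\<close>, has coefficients
    in \<open>K\<close>; \<open>H\<close>, the one at \<open>x\<close>, carries the estimates. The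
    integral shift \<open>s\<close> links the two.\<close>
  define H where "H = smult (1 / k) (pcompose G [:0, e:])"
  define r where "r = smult (1 / k) (pcompose F [:c, e:])"
  have coeff_H: "coeff H i = coeff G i * e ^ i / k" for i
    by (simp add: H_def coeff_pcompose_linear)
  have rH: "r = pcompose H [:s, 1:]"
  proof -
    have "pcompose [:0, e:] [:s, 1:] = [:c - x, e:]"
      using e by (simp add: s_def pcompose_pCons)
    then have "pcompose H [:s, 1:] = smult (1 / k) (pcompose G [:c - x, e:])"
      by (simp add: H_def pcompose_smult flip: pcompose_assoc)
    also have "pcompose G [:c - x, e:] = pcompose F [:c, e:]"
      unfolding G_def pcompose_assoc[symmetric] by (simp add: pcompose_pCons)
    finally show ?thesis by (simp add: r_def)
  qed
  have H0: "coeff H 0 \<preceq> 1"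
  proof -
    have "coeff G 0 \<preceq> k"
      using vle_trans[OF vle_trans[OF G0 vle_mult[OF vle_refl e(4)]] k(4)] .
    then show ?thesis unfolding coeff_H using k by (simp add: divide_vle_one)
  qed
  have H1: "coeff H 1 \<preceq> 1" "1 \<preceq> coeff H 1"
    using k by (simp_all add: coeff_H divide_vle_one one_vle_divide)
  have H2: "coeff H i \<prec> 1" if i: "i \<ge> 2" for i
  proof -
    obtain m where m: "i = Suc m" "m \<ge> 1" using i by (cases i) auto
    have "coeff G i * e ^ m \<preceq> coeff G i * (x - c) ^ m"
      using e by (intro vle_mult vle_power) auto
    moreover have "coeff G i * (x - c) ^ m \<prec> coeff G 1" using dom m by simp
    ultimately have "coeff G i * e ^ m \<prec> coeff G 1" by (rule vle_vlt_trans)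
    then have "coeff G i * e ^ m * e \<prec> coeff G 1 * e" by (rule iffD2[OF vlt_mult_cancel[OF e(2)]])
    then have "coeff G i * e ^ i \<prec> coeff G 1 * e" by (simp add: m mult_ac)
    then have "coeff G i * e ^ i \<prec> k" using k(4) by (rule vlt_vle_trans)
    then show ?thesis unfolding coeff_H using k by (simp add: divide_vlt_one)
  qed
  define H' where "H' = H - [:coeff H 0, coeff H 1:]"
  have H': "poly_vlt_one H'"
    unfolding poly_vlt_one_def
  proof
    fix i :: nat
    have "i = 0 \<or> i = 1 \<or> i \<ge> 2" by linarith
    then show "coeff H' i \<prec> 1"
      using H2[of i] by (auto simp: H'_def coeff_pCons split: nat.splits)
  qed
  define H'' where "H'' = pcompose H' [:s, 1:]"
  have H'': "coeff H'' i \<prec> 1" for i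
    using poly_vlt_one_pcompose[OF H', of "[:s, 1:]"] s
    by (simp add: H''_def poly_vlt_one_def V.poly_over_pCons mem_iff_vle)
  have "r = pcompose [:coeff H 0, coeff H 1:] [:s, 1:] + H''"
    unfolding rH H''_def by (simp add: H'_def pcompose_diff)
  then have r: "r = [:coeff H 0 + s * coeff H 1, coeff H 1:] + H''"
    by (simp add: pcompose_pCons)
  have rK: "poly_over K r" unfolding r_def
    using c e k by (intro K.poly_over_smult K.poly_over_pcompose K.poly_over_pCons F K.divide_mem) auto
  have "coeff r i \<preceq> 1" for i
    unfolding r using H''[of i] H0 H1(1) vle_mult[OF s H1(1)]
    by (auto simp: coeff_pCons vlt_imp_vle intro!: vle_add split: nat.split)
  then have rA: "poly_over A r"
    using rK by (simp add: poly_over_def mem_A_iff)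
  have r1: "1 \<preceq> coeff r 1"
  proof (rule ccontr)
    assume "\<not> 1 \<preceq> coeff r 1"
    then have "coeff r 1 - coeff H'' 1 \<prec> 1" by (intro vlt_diff H'') (simp add: vlt_def)
    then show False using H1(2) by (simp add: r vlt_def)
  qed
  have r2: "coeff r i \<prec> 1" if "i \<ge> 2" for i
    using H''[of i] that by (auto simp: r coeff_pCons split: nat.split)
  obtain y where y: "y \<in> A" "poly r y = 0" by (rule hensel_linear[OF rA r1 r2])
  show ?thesis
  proof (rule that)
    show "c + e * y \<in> K" using c e y by (intro K.mem_intros) (auto simp: mem_A_iff)
    show "poly F (c + e * y) = 0" using y(2) k by (simp add: r_def poly_pcompose mult.commute)
    have "y * e \<preceq> x - c" using y e by (intro vle_one_mult) (auto simp: mem_A_iff)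
    then have "(x - c) - y * e \<preceq> x - c" by (rule vle_diff[OF vle_refl])
    then show "x - (c + e * y) \<preceq> x - c" by (simp add: algebra_simps)
  qed
qed

text \<open>The induction passes to the derivative: as \<open>|k| = 1\<close> for \<open>0 < k < p\<close>, the claim for \<open>F'\<close> says that
  the linear term of the Taylor expansion of \<open>F\<close> dominates the higher ones near \<open>x\<close>. If it never became
  smaller than the constant term, then Hensel's lemma would give a root \<open>b \<in> K\<close> of \<open>F\<close> and
  \<open>|F(x)| = |F'(x) (x - b)|\<close>, whereas \<open>b\<close> is not a best approximation of \<open>x\<close>.\<close>
lemma taylor_dominance:
  assumes x: "x \<notin> K"
  shows "poly_over K F \<Longrightarrow> F \<noteq> 0 \<Longrightarrow> degree F < p \<Longrightarrow>
    \<exists>c\<in>K. \<forall>k>0. coeff (pcompose F [:x, 1:]) k * (x - c) ^ k \<prec> poly F x"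
proof (induction "degree F" arbitrary: F rule: less_induct)
  case less
  show ?case
  proof (cases "degree F = 0")
    case True
    then obtain a where a: "F = [:a:]" by (rule degree_eq_zeroE)
    then show ?thesis using less.prems
      by (intro bexI[of _ 0]) (auto simp: coeff_pCons split: nat.split)
  next
    case False
    define G where "G = pcompose F [:x, 1:]"
    have dG: "pderiv G = pcompose (pderiv F) [:x, 1:]"
      by (simp add: G_def pderiv_pcompose pderiv_pCons)
    have G0: "coeff G 0 = poly F x" by (simp add: G_def)
    have "coeff G 1 = coeff (pderiv G) 0" by (simp add: coeff_pderiv)
    also have "\<dots> = poly (pderiv F) x" unfolding dG by simp
    finally have G1: "coeff G 1 = poly (pderiv F) x" .
    have deg_G: "degree G = degree F" by (simp add: G_def degree_pcompose)
    obtain c1 where c1: "c1 \<in> K"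
      and c1_dom: "\<And>k. k > 0 \<Longrightarrow> coeff (pderiv G) k * (x - c1) ^ k \<prec> coeff G 1"
    proof -
      have "\<exists>c\<in>K. \<forall>k>0. coeff (pcompose (pderiv F) [:x, 1:]) k * (x - c) ^ k \<prec> poly (pderiv F) x"
        using False less.prems
        by (intro less.hyps) (auto simp: degree_pderiv pderiv_eq_0_iff K.poly_over_pderiv)
      then show ?thesis using that unfolding dG G1 by blast
    qed
    have G1_0: "coeff G 1 \<noteq> 0" using vlt_nonzero[OF c1_dom[of 1]] by simp
    have dom: "coeff G (Suc m) * s ^ m \<prec> coeff G 1" if m: "m \<ge> 1" and s: "s \<preceq> x - c1" for m s
    proof (cases "Suc m < p")
      case True
      have "coeff G (Suc m) * s ^ m \<preceq> coeff G (Suc m) * (x - c1) ^ m"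
        by (intro vle_mult vle_power s) simp
      then have "1 * (coeff G (Suc m) * s ^ m) \<preceq> of_nat (Suc m) * (coeff G (Suc m) * (x - c1) ^ m)"
        by (rule vle_mult[OF of_nat_unit[OF zero_less_Suc True]])
      moreover have "of_nat (Suc m) * (coeff G (Suc m) * (x - c1) ^ m) \<prec> coeff G 1"
        using c1_dom[of m] m by (simp add: coeff_pderiv mult.assoc)
      ultimately show ?thesis using vle_vlt_trans by simp
    next
      case False
      then have "coeff G (Suc m) = 0" using less.prems deg_G by (intro coeff_eq_0) simp
      then show ?thesis using G1_0 by simp
    qed
    show ?thesis
    proof (rule ccontr)
      assume "\<not> ?thesis"
      then have neg: "\<exists>k>0. coeff G 0 \<preceq> coeff G k * (x - c) ^ k" if "c \<in> K" for c
        using that unfolding G_def[symmetric] G0 vlt_def by blast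
      \<comment> \<open>For \<open>c\<close> as close to \<open>x\<close> as \<open>c1\<close> the
        linear term bounds the higher ones, so whichever term keeps up with the constant one, the
        linear term does too.\<close>
      have star: "coeff G 0 \<preceq> coeff G 1 * (x - c)" if c: "c \<in> K" "x - c \<preceq> x - c1" for c
      proof -
        obtain m where m: "coeff G 0 \<preceq> coeff G (Suc m) * (x - c) ^ Suc m"
          using neg[OF c(1)] by (metis gr0_implies_Suc)
        show ?thesis
        proof (cases "m = 0")
          case False
          then have "coeff G (Suc m) * (x - c) ^ m \<preceq> coeff G 1"
            using dom[OF _ c(2)] vlt_imp_vle by simp
          from vle_mult_right[OF this, of "x - c"] show ?thesis
            using m by (auto simp: mult_ac intro: vle_trans)
        qed (use m in simp)
      qed
      have "x \<noteq> c1" using x c1 by auto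
      then obtain b where b: "b \<in> K" "x - b \<preceq> x - c1" "poly F b = 0"
        using ex_root_near[OF less.prems(1) c1 _ G_def G1_0 dom star[OF c1]] by auto
      \<comment> \<open>\<open>star\<close> at a \<open>c\<close> closer than \<open>b\<close> makes
        the constant term smaller than the linear one. In \<open>G(b - x) = F(b) = 0\<close> the
        linear term then strictly dominates all others, which is absurd.\<close>
      obtain c where c: "c \<in> K" "x - c \<prec> x - b" using ex_better_approx[OF x b(1)] .
      have xb: "x - b \<noteq> 0" using x b by auto
      have bx: "b - x \<preceq> x - b" "b - x \<preceq> x - c1"
        using b(2) by (simp_all add: vle_minus_commute(1)[of b])
      have lin_0: "coeff G 1 * (b - x) \<noteq> 0" using G1_0 xb by simp
      have "coeff G 0 \<preceq> (x - c) * coeff G 1"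
        using star[OF c(1)] vle_trans[OF vlt_imp_vle[OF c(2)] b(2)] by (simp add: mult.commute)
      moreover have "(x - c) * coeff G 1 \<prec> (x - b) * coeff G 1"
        using iffD2[OF vlt_mult_cancel[OF G1_0] c(2)] .
      ultimately have "coeff G 0 \<prec> (x - b) * coeff G 1" by (rule vle_vlt_trans)
      then have "coeff G 0 \<prec> - ((x - b) * coeff G 1)" by simp
      then have small0: "coeff G 0 \<prec> coeff G 1 * (b - x)" by (simp add: algebra_simps)
      have small: "(\<Sum>k\<in>{2..degree G}. coeff G k * (b - x) ^ k) \<prec> coeff G 1 * (b - x)"
      proof (rule vlt_sum[OF lin_0])
        fix k assume "k \<in> {2..degree G}"
        then obtain m where m: "k = Suc m" "m \<ge> 1" by (cases k) auto
        have "coeff G (Suc m) * (b - x) ^ m * (b - x) \<prec> coeff G 1 * (b - x)"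
          using vlt_mult[OF dom[OF m(2) bx(2)] vle_refl[of "b - x"]] xb by simp
        then show "coeff G k * (b - x) ^ k \<prec> coeff G 1 * (b - x)" by (simp add: m mult_ac)
      qed
      have "poly G (b - x) = 0" using b(3) by (simp add: G_def poly_pcompose)
      then have "coeff G 1 * (b - x) = - (coeff G 0 + (\<Sum>k\<in>{2..degree G}. coeff G k * (b - x) ^ k))"
        unfolding poly_split_linear[of G] by (simp add: eq_neg_iff_add_eq_0 algebra_simps)
      moreover have "- (coeff G 0 + (\<Sum>k\<in>{2..degree G}. coeff G k * (b - x) ^ k)) \<prec> coeff G 1 * (b - x)"
        using vlt_add[OF small0 small] by (simp only: vlt_uminus)
      ultimately show False by (metis vlt_irrefl)
    qed
  qed
qed

text \<open>By \<open>taylor_dominance\<close> the Taylor terms at \<open>x\<close> are bounded by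
  \<open>F(x)\<close>, hence integral; moving the centre from \<open>x\<close> to \<open>c\<close>
  in the scale \<open>e\<close> is a shift by the integral \<open>(c - x) / e\<close>.\<close>

lemma ex_expansion_over_A:
  assumes x: "x \<notin> K" and F: "poly_over K F" "degree F < p" and Fx: "poly F x \<preceq> 1" and c0: "c0 \<in> K"
  obtains c where "c \<in> K" "x - c \<preceq> x - c0"
    "\<And>e. e \<in> K \<Longrightarrow> e \<preceq> x - c \<Longrightarrow> x - c \<preceq> e \<Longrightarrow> poly_over A (pcompose F [:c, e:])"
proof (cases "F = 0")
  case True
  then show ?thesis using that[of c0] c0 by simp
next
  case False
  define G where "G = pcompose F [:x, 1:]"
  obtain c1 where c1: "c1 \<in> K" and dom: "\<And>k. k > 0 \<Longrightarrow> coeff G k * (x - c1) ^ k \<prec> poly F x"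
    using taylor_dominance[OF x F(1) False F(2)] unfolding G_def by blast
  \<comment> \<open>\<open>c\<close> is the closer of \<open>c0\<close> and \<open>c1\<close>; the
    bounds known for \<open>c1\<close> persist at closer points.\<close>
  obtain c where c: "c \<in> K" "x - c \<preceq> x - c0" "x - c \<preceq> x - c1"
    using c0 c1 vle_total[of "x - c0" "x - c1"] vle_refl by blast
  show ?thesis
  proof (rule that[OF c(1,2)])
    fix e assume e: "e \<in> K" "e \<preceq> x - c" "x - c \<preceq> e"
    have e0: "e \<noteq> 0" using e x c by auto
    have G_bound: "coeff G k * e ^ k \<preceq> 1" for k
    proof (cases "k = 0")
      case False
      have "coeff G k * e ^ k \<preceq> coeff G k * (x - c1) ^ k"
        using vle_trans[OF e(2) c(3)] by (intro vle_mult vle_power) simp_all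
      then show ?thesis using vle_vlt_trans[OF _ dom[of k]] Fx False vle_trans vlt_imp_vle by blast
    qed (simp add: G_def Fx)
    have "pcompose F [:c, e:] = pcompose (pcompose G [:0, e:]) [:(c - x) / e, 1:]"
      unfolding G_def using e0 by (simp add: pcompose_pCons flip: pcompose_assoc)
    moreover have "poly_over OL (pcompose G [:0, e:])"
      using G_bound by (simp add: poly_over_def coeff_pcompose_linear mem_iff_vle mult.commute)
    moreover have "(c - x) / e \<preceq> 1"
      using e(3) by (simp add: divide_vle_one[OF e0] vle_minus_commute(1)[of c])
    ultimately have "poly_over OL (pcompose F [:c, e:])"
      by (simp add: V.poly_over_pcompose V.poly_over_pCons mem_iff_vle)
    then show "poly_over A (pcompose F [:c, e:])"
      using F c e by (simp add: poly_over_A_iff K.poly_over_pcompose K.poly_over_pCons)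
  qed
qed

end

section \<open>Kummer extensions with defect\<close>

locale defect_kummer = immediate_extension OL K A p + kummer_extension K p \<zeta> \<theta>
  for OL K A :: "'a::field_char_0 set" and p :: nat and \<zeta> \<theta> :: 'a
begin

abbreviation z :: 'a where "z \<equiv> \<zeta> - 1"

definition S :: "'a set" where
  "S = {\<alpha>. \<alpha> ^ p \<in> {h \<in> kummer_gens K p. h \<in> ring_units A \<and> h - 1 \<in> max_ideal A}}"

lemma zeta_power_unit: "\<zeta> ^ j \<preceq> 1" "1 \<preceq> \<zeta> ^ j"
  using unit_if_power_unit[of "\<zeta> ^ j" p] zeta_pow p_pos
  by (simp_all add: power_mult[symmetric] mult.commute[of j] power_mult)

lemma z_nonzero: "z \<noteq> 0"
  using zeta(2) p_gt_1 unfolding primitive_root_def by force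

lemma power_minus_one_vle: "x \<preceq> 1 \<Longrightarrow> x ^ j - 1 \<preceq> x - 1"
  unfolding power_diff_1_eq using V.sum_mem[of "{..<j}" "\<lambda>i. x ^ i"] V.power_mem
  by (subst mult.commute) (auto simp: mem_iff_vle intro: vle_one_mult)

lemma zeta_power_minus_one_vle: "\<zeta> ^ j - 1 \<preceq> z"
  using power_minus_one_vle zeta_power_unit[of 1] by simp

text \<open>By Bezout \<open>\<zeta>\<close> is itself a power of \<open>\<zeta> ^ j\<close>, so
  \<open>power_minus_one_vle\<close> also applies with the two exchanged.\<close>

lemma z_vle_zeta_power_minus_one:
  assumes "0 < j" "j < p" shows "z \<preceq> \<zeta> ^ j - 1"
proof -
  obtain x y where xy: "j * x = p * y + 1" using bezout_prime[OF p assms] .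
  have "(\<zeta> ^ j) ^ x = \<zeta>"
    unfolding power_mult[symmetric] xy by (simp add: power_add power_mult zeta_pow)
  then show ?thesis using power_minus_one_vle[OF zeta_power_unit(1)[of j], of x] by simp
qed

text \<open>The product equals \<open>((e X + c)^p - \<alpha>^p) / e^p\<close>, hence is over
  \<open>K\<close>; its roots lie in \<open>OL\<close>, hence so do its coefficients.\<close>

lemma prod_conjugates_over_A:
  assumes a: "\<alpha> ^ p \<in> K" "\<alpha> \<noteq> 0" and c: "c \<in> K" and e: "e \<in> K" "e \<noteq> 0"
    and int: "\<And>j. j < p \<Longrightarrow> (\<zeta> ^ j * \<alpha> - c) / e \<preceq> 1"
  shows "poly_over A (\<Prod>j<p. [:- ((\<zeta> ^ j * \<alpha> - c) / e), 1:])"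
  unfolding poly_over_A_iff
proof
  show "poly_over OL (\<Prod>j<p. [:- ((\<zeta> ^ j * \<alpha> - c) / e), 1:])"
    using int by (intro V.poly_over_prod V.poly_over_pCons) (auto simp: mem_iff_vle)
  have lin: "[:- ((\<zeta> ^ j * \<alpha> - c) / e), 1:] = [:1 / e:] * pcompose [:- (\<zeta> ^ j * \<alpha>), 1:] [:c, e:]" for j
    using e by (simp add: pcompose_pCons field_simps)
  have "(\<Prod>j<p. [:- ((\<zeta> ^ j * \<alpha> - c) / e), 1:]) = [:1 / e:] ^ p * pcompose (monom 1 p - [:\<alpha> ^ p:]) [:c, e:]"
    unfolding lin prod.distrib power_minus_factorization[OF zeta(2) p_pos a(2)] pcompose_prod by simp
  also have "poly_over K \<dots>"
    using a c e by (intro K.poly_over_mult K.poly_over_power K.poly_over_pcompose K.poly_over_diff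
      K.poly_over_monom K.poly_over_pCons) (auto intro: K.divide_mem)
  finally show "poly_over K (\<Prod>j<p. [:- ((\<zeta> ^ j * \<alpha> - c) / e), 1:])" .
qed

lemma lead_coeff_prod_linear: "lead_coeff (\<Prod>j\<in>J. [:- r j, 1:]) = 1"
  for r :: "'b \<Rightarrow> 'a"
  by (subst lead_coeff_prod) simp

text \<open>Otherwise \<open>(\<alpha> - 1) / z\<close> would be a simple residual zero among the \<open>(\<zeta>^j \<alpha> - 1) / z\<close>, since these
  differ by units, and Hensel's lemma would put \<open>\<alpha>\<close> into \<open>K\<close>.\<close>
lemma z_vle_minus_one:
  assumes a: "\<alpha> ^ p \<in> K" "\<alpha> \<notin> K" and unit: "\<alpha> \<preceq> 1" "1 \<preceq> \<alpha>"
  shows "z \<preceq> \<alpha> - 1"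
proof (rule ccontr)
  assume "\<not> z \<preceq> \<alpha> - 1"
  then have close: "\<alpha> - 1 \<prec> z" by (simp add: vlt_def)
  define t where "t j = (\<zeta> ^ j * \<alpha> - 1) / z" for j :: nat
  have t0: "t 0 \<prec> 1" using close z_nonzero by (simp add: t_def divide_vlt_one)
  have t_eq: "t j = (\<zeta> ^ j - 1) * \<alpha> / z + t 0" for j
    by (simp add: t_def add_divide_distrib[symmetric] algebra_simps)
  have t_int: "t j \<preceq> 1" for j
    unfolding t_eq[of j] using vle_mult[OF zeta_power_minus_one_vle unit(1), of j] z_nonzero t0
    by (intro vle_add) (simp_all add: divide_vle_one vlt_imp_vle)
  have t_unit: "1 \<preceq> - t j" if j: "0 < j" "j < p" for j
  proof (rule ccontr)
    assume "\<not> 1 \<preceq> - t j"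
    then have "t j - t 0 \<prec> 1" by (intro vlt_diff t0) (simp add: vlt_def)
    then have "(\<zeta> ^ j - 1) * \<alpha> \<prec> z"
      using z_nonzero by (simp add: t_eq[of j] divide_vlt_one)
    moreover have "z \<preceq> (\<zeta> ^ j - 1) * \<alpha>"
      using vle_mult[OF z_vle_zeta_power_minus_one[OF j] unit(2)] by simp
    ultimately show False by (simp add: vlt_def)
  qed
  define f where "f = (\<Prod>j<p. [:- t j, 1:])"
  \<comment> \<open>Removing the factor of \<open>t 0\<close>, which is in the maximal ideal, leaves
    \<open>Q\<close> with a unit as constant term; hence 0 is a simple residual root of
    \<open>f\<close>.\<close>
  define Q where "Q = (\<Prod>j\<in>{1..<p}. [:- t j, 1:])"
  have f_A: "poly_over A f" unfolding f_def t_def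
    using a z_nonzero t_int zeta by (intro prod_conjugates_over_A) (auto simp: t_def intro: K.diff_mem)
  have lead: "lead_coeff f = 1" unfolding f_def by (rule lead_coeff_prod_linear)
  have Q_OL: "poly_over OL Q" unfolding Q_def
    using t_int by (intro V.poly_over_prod V.poly_over_pCons) (auto simp: mem_iff_vle)
  have "{..<p} = insert 0 {1..<p}" using p_pos by auto
  then have fQ: "f = [:- t 0, 1:] * Q" unfolding f_def Q_def by simp
  have Q_0: "1 \<preceq> poly Q 0" unfolding Q_def poly_prod
    using t_unit by (intro one_vle_prod) auto
  have small: "t 0 * w \<prec> 1" if "w \<in> OL" for w
    using vlt_mult[OF t0, of w 1] that by (simp add: mem_iff_vle)
  have "poly f 0 = - (t 0 * poly Q 0)" by (simp add: fQ)
  then have root: "poly f 0 \<in> max_ideal A"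
    using small[OF V.poly_mem[OF Q_OL]] A.poly_mem[OF f_A, of 0] by (simp add: max_ideal_A_iff mem_A_iff)
  have df: "poly (pderiv f) 0 = poly Q 0 - t 0 * poly (pderiv Q) 0"
    unfolding fQ pderiv_mult by (simp add: pderiv_pCons)
  have "1 \<preceq> poly (pderiv f) 0"
  proof (rule ccontr)
    assume "\<not> 1 \<preceq> poly (pderiv f) 0"
    then have "poly (pderiv f) 0 + t 0 * poly (pderiv Q) 0 \<prec> 1"
      by (intro vlt_add small V.poly_mem V.poly_over_pderiv Q_OL) (auto simp: vlt_def)
    then show False using Q_0 by (simp add: df vlt_def)
  qed
  moreover have "poly (pderiv f) 0 \<in> A" by (intro A.poly_mem A.poly_over_pderiv f_A) simp
  ultimately have "poly (pderiv f) 0 \<in> ring_units A"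
    by (simp add: ring_units_A_iff mem_A_iff)
  then obtain b where b: "b \<in> A" "poly f b = 0"
    using hensel f_A lead root A.zero_mem unfolding henselian_def by blast
  \<comment> \<open>The root may be any of the \<open>t j\<close>, but each of them in
    \<open>K\<close> already puts \<open>\<alpha>\<close> into \<open>K\<close>.\<close>
  then obtain j where j: "b = t j" by (auto simp: f_def poly_prod prod_zero_iff)
  have "\<alpha> = (1 + b * z) / \<zeta> ^ j"
    using z_nonzero zeta_nonzero by (simp add: j t_def)
  also have "\<dots> \<in> K"
    using b zeta by (intro K.divide_mem K.mem_intros) (auto simp: mem_A_iff)
  finally show False using a by simp
qed

text \<open>The conjugates \<open>t j\<close> differ from this element by
  \<open>g * (\<zeta> ^ j - 1) / z * \<alpha>\<close>, so all lie in \<open>OL\<close> and the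
  product of their linear factors gives a monic equation over \<open>A\<close>.\<close>

lemma normalized_integral:
  assumes a: "\<alpha> ^ p \<in> K" "\<alpha> \<preceq> 1" "\<alpha> \<noteq> 0" and g: "g \<in> A" "g \<noteq> 0"
    and y: "g * (\<alpha> - 1) / z \<preceq> 1"
  shows "g * (\<alpha> - 1) / z \<in> integral_closure A"
proof -
  define t where "t j = (\<zeta> ^ j * \<alpha> - 1) / (z / g)" for j :: nat
  have t0: "t 0 = g * (\<alpha> - 1) / z" by (simp add: t_def mult.commute)
  have t_int: "t j \<preceq> 1" for j
  proof -
    have "t j = (g * ((\<zeta> ^ j - 1) * \<alpha>) + g * (\<alpha> - 1)) / z"
      by (simp add: t_def algebra_simps)
    then have "t j = g * ((\<zeta> ^ j - 1) / z * \<alpha>) + g * (\<alpha> - 1) / z"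
      by (simp add: add_divide_distrib)
    moreover have "(\<zeta> ^ j - 1) / z \<preceq> 1"
      using zeta_power_minus_one_vle z_nonzero by (simp add: divide_vle_one)
    then have "g * ((\<zeta> ^ j - 1) / z * \<alpha>) \<preceq> 1"
      using a g by (intro vle_one_mult) (auto simp: mem_A_iff)
    ultimately show ?thesis using y by (simp add: vle_add)
  qed
  have "z / g \<in> K" using g zeta by (intro K.divide_mem K.diff_mem) (auto simp: mem_A_iff)
  then have "poly_over A (\<Prod>j<p. [:- t j, 1:])"
    unfolding t_def using a g z_nonzero t_int
    by (intro prod_conjugates_over_A) (auto simp: t_def)
  moreover have "poly (\<Prod>j<p. [:- t j, 1:]) (t 0) = 0"
    using p_pos by (auto simp: poly_prod intro!: prod_zero)
  ultimately show ?thesis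
    unfolding t0[symmetric] integral_closure_def
    by (intro CollectI exI[of _ "\<Prod>j<p. [:- t j, 1:]"] conjI) (simp_all only: lead_coeff_prod_linear)
qed

section \<open>The rings \<open>A[\<alpha>']\<close>: normalization, covering and chain
  property\<close>

lemma S_properties:
  assumes "\<alpha> \<in> S"
  shows "\<alpha> ^ p \<in> K" "\<alpha> \<notin> K" "\<alpha> \<preceq> 1" "1 \<preceq> \<alpha>" "generates K {\<alpha>}"
proof -
  have h: "generates K {x. x ^ p = \<alpha> ^ p}" "\<alpha> ^ p \<preceq> 1" "1 \<preceq> \<alpha> ^ p"
    and a: "\<alpha> ^ p \<in> K"
    using assms by (auto simp: S_def kummer_gens_def ring_units_A_iff)
  show "\<alpha> ^ p \<in> K" by fact
  show unit: "\<alpha> \<preceq> 1" "1 \<preceq> \<alpha>" using unit_if_power_unit[OF h(2,3) p_pos] .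
  show "generates K {\<alpha>}"
    unfolding generates_def
  proof (intro allI impI)
    fix F assume F: "subfield F \<and> K \<subseteq> F \<and> {\<alpha>} \<subseteq> F"
    \<comment> \<open>All \<open>p\<close>-th roots of \<open>\<alpha> ^ p\<close> are multiples of
      \<open>\<alpha>\<close> by powers of \<open>\<zeta>\<close>, so \<open>\<alpha>\<close> alone
      generates what they generate together.\<close>
    have "x \<in> F" if "x ^ p = \<alpha> ^ p" for x
    proof -
      have a0: "\<alpha> \<noteq> 0" using unit by auto
      have "(x / \<alpha>) ^ p = 1" using that a0 by (simp add: power_divide)
      then obtain j where "x / \<alpha> = \<zeta> ^ j" by (rule pth_root_of_unity)
      then have "x = \<zeta> ^ j * \<alpha>" using a0 by (simp add: field_simps)
      moreover have "\<zeta> ^ j \<in> F" using F zeta K.power_mem by blast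
      ultimately show ?thesis using F by (auto simp: subfield_def)
    qed
    then have "{x. x ^ p = \<alpha> ^ p} \<subseteq> F" by auto
    then show "F = UNIV" using h(1)[unfolded generates_def, rule_format, of F] F by simp
  qed
  show "\<alpha> \<notin> K"
  proof
    assume "\<alpha> \<in> K"
    then have "K = UNIV"
      using \<open>generates K {\<alpha>}\<close>[unfolded generates_def, rule_format, of K] K by simp
    then show False using theta by simp
  qed
qed

text \<open>Source of elements of \<open>S\<close>: dividing by \<open>c\<close> recovers
  \<open>\<theta>\<close>, which gives generation, and \<open>\<alpha> ^ p - 1\<close> is an
  integral multiple of \<open>\<alpha> - 1\<close>.\<close>

lemma theta_multiple_in_S:
  assumes "\<alpha> = \<theta> * c" "c \<in> K" "c \<noteq> 0" "\<alpha> - 1 \<prec> 1"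
  shows "\<alpha> \<in> S"
proof -
  have a: "\<alpha> ^ p \<in> K" using assms theta by (auto simp: power_mult_distrib intro: K.mem_intros)
  have "1 \<preceq> \<alpha>" using vle_of_diff_vlt[of 1 \<alpha>] assms(4) vlt_uminus(1)[of "\<alpha> - 1" 1] by simp
  moreover have "\<alpha> \<preceq> 1" using vle_add[of "\<alpha> - 1" 1 1] assms(4) vlt_imp_vle by simp
  ultimately have "1 \<preceq> \<alpha> ^ p" "\<alpha> ^ p \<preceq> 1"
    using vle_power[of 1 \<alpha> p] vle_power[of \<alpha> 1 p] by simp_all
  moreover have "\<alpha> ^ p - 1 \<prec> 1"
    using power_minus_one_vle[OF \<open>\<alpha> \<preceq> 1\<close>] assms(4) vle_vlt_trans by blast
  moreover have "generates K {x. x ^ p = \<alpha> ^ p}"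
    unfolding generates_def
  proof (intro allI impI)
    fix F assume F: "subfield F \<and> K \<subseteq> F \<and> {x. x ^ p = \<alpha> ^ p} \<subseteq> F"
    then have "\<alpha> \<in> F" "inverse c \<in> F" using assms K.inverse_mem by blast+
    then have "\<alpha> * inverse c \<in> F" using F by (auto simp: subfield_def)
    moreover have "\<alpha> * inverse c = \<theta>" using assms(3) by (simp add: assms(1) mult.assoc)
    ultimately have "\<theta> \<in> F" by simp
    then show "F = UNIV" using F gen[unfolded generates_def, rule_format, of F] by simp
  qed
  ultimately show ?thesis
    using a by (simp add: S_def kummer_gens_def ring_units_A_iff max_ideal_A_iff K.diff_mem)
qed

text \<open>\<open>g\<close> is the inverse of some \<open>c\<close> in \<open>K\<close> with the
  value of \<open>(\<alpha> - 1) / z\<close>; \<open>z_vle_minus_one\<close> gives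
  \<open>1 \<preceq> c\<close>, which puts \<open>g\<close> into \<open>A\<close>.\<close>

lemma ex_normalizer:
  assumes "\<alpha> \<in> S"
  obtains g where "g \<in> A" "g * (\<alpha> - 1) / z \<in> ring_units OL"
proof -
  note a = S_properties[OF assms]
  have "(\<alpha> - 1) / z \<noteq> 0" using a(2) z_nonzero by auto
  then obtain c where c: "c \<in> K" "c \<noteq> 0" "c \<preceq> (\<alpha> - 1) / z" "(\<alpha> - 1) / z \<preceq> c"
    by (rule ex_same_value)
  have "1 \<preceq> (\<alpha> - 1) / z" using z_vle_minus_one[OF a(1-4)] z_nonzero by (simp add: one_vle_divide)
  then have "1 \<preceq> c" using c(4) vle_trans by blast
  show ?thesis
  proof (rule that)
    show "1 / c \<in> A" using c \<open>1 \<preceq> c\<close> by (auto simp: mem_A_iff divide_vle_one intro: K.divide_mem)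
    have "(\<alpha> - 1) / z / c \<in> ring_units OL"
      using c(3,4) unfolding ring_units_iff divide_vle_one[OF c(2)] one_vle_divide[OF c(2)] by simp
    then show "1 / c * (\<alpha> - 1) / z \<in> ring_units OL" by (simp add: field_simps)
  qed
qed

text \<open>\<open>\<beta>\<close> is a polynomial in some \<open>a\<close> congruent to 1; it is
  expanded at \<open>c\<close> close to \<open>a\<close>, and \<open>\<alpha> = a / c\<close>. As
  \<open>a - c = c (\<alpha> - 1)\<close>, this is an expansion in \<open>\<alpha>'\<close>, for
  every admissible \<open>g\<close> at once.\<close>

lemma ex_covering:
  assumes "\<beta> \<in> OL"
  obtains \<alpha> where "\<alpha> \<in> S" "\<And>g. g \<in> A \<Longrightarrow> g * (\<alpha> - 1) / z \<in> ring_units OL \<Longrightarrow>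
    \<beta> \<in> ring_adj A (g * (\<alpha> - 1) / z)"
proof -
  obtain d where d: "d \<in> K" "\<theta> - d \<prec> \<theta>" using ex_closer[OF theta_nonzero] .
  then have d0: "d \<noteq> 0" by auto
  define a where "a = \<theta> / d"
  have "\<theta> - d \<prec> d" using d(2) vle_of_diff_vlt[OF d(2)] vlt_vle_trans by blast
  then have a1: "a - 1 \<prec> 1" unfolding a_def
    using d0 by (simp add: divide_vlt_one divide_diff_eq_iff)
  have "a \<in> S" using theta_multiple_in_S[of a "1 / d"] d d0 a1 by (simp add: a_def K.divide_mem)
  note a = S_properties[OF this]
  interpret a: kummer_extension K p \<zeta> a
    by unfold_locales (use a p K zeta in auto)
  obtain F where F: "poly_over K F" "degree F < p" "\<beta> = poly F a" by (rule a.ex_poly)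
  \<comment> \<open>Starting from the approximation 1 keeps \<open>c\<close> congruent to 1, so that
    \<open>a / c\<close> stays in \<open>S\<close>.\<close>
  obtain c where c: "c \<in> K" "a - c \<preceq> a - 1"
    and over: "\<And>e. e \<in> K \<Longrightarrow> e \<preceq> a - c \<Longrightarrow> a - c \<preceq> e \<Longrightarrow> poly_over A (pcompose F [:c, e:])"
    using ex_expansion_over_A[OF a(2) F(1,2) _ K.one_mem] assms F(3) by (auto simp: mem_iff_vle)
  have ac: "a - c \<prec> 1" using c(2) a1 by (rule vle_vlt_trans)
  have "1 - c \<prec> 1" using vlt_diff[OF ac a1] by simp
  then have "1 \<preceq> c" by (rule vle_of_diff_vlt)
  then have c0: "c \<noteq> 0" by auto
  have ac1: "a / c - 1 = (a - c) / c" using c0 by (simp add: diff_divide_distrib)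
  have "a / c \<in> S"
  proof (rule theta_multiple_in_S)
    show "a / c = \<theta> * (1 / (d * c))" by (simp add: a_def)
    show "1 / (d * c) \<in> K" using d c by (intro K.divide_mem K.mult_mem) auto
    show "1 / (d * c) \<noteq> 0" using d0 c0 by simp
    show "a / c - 1 \<prec> 1"
      unfolding ac1 divide_vlt_one[OF c0] using ac \<open>1 \<preceq> c\<close> by (rule vlt_vle_trans)
  qed
  moreover have "\<beta> \<in> ring_adj A (g * (a / c - 1) / z)"
    if g: "g \<in> A" and unit: "g * (a / c - 1) / z \<in> ring_units OL" for g
  proof -
    define y where "y = g * (a / c - 1) / z"
    \<comment> \<open>Chosen such that \<open>c + e * y = a\<close>; as \<open>y\<close> is a unit,
      \<open>e\<close> has the value of \<open>a - c\<close> that \<open>over\<close>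
      requires.\<close>
    define e where "e = c * z / g"
    have y: "y \<preceq> 1" "1 \<preceq> y" using unit by (simp_all add: y_def ring_units_iff)
    then have y0: "y \<noteq> 0" by auto
    then have g0: "g \<noteq> 0" by (auto simp: y_def)
    have ye: "y * e = a - c" using g0 c0 z_nonzero by (simp add: y_def e_def ac1)
    have e_K: "e \<in> K" unfolding e_def using c g zeta
      by (intro K.divide_mem K.mult_mem K.diff_mem) (auto simp: mem_A_iff)
    have "poly_over A (pcompose F [:c, e:])"
      using over[OF e_K] vle_mult[OF y(1) vle_refl[of e]] vle_mult[OF y(2) vle_refl[of e]]
      by (simp add: ye)
    moreover have "\<beta> = poly (pcompose F [:c, e:]) y"
      using ye by (simp add: F(3) poly_pcompose)
    ultimately show ?thesis unfolding ring_adj_def y_def by blast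
  qed
  ultimately show ?thesis using that by blast
qed

text \<open>Each \<open>\<beta>\<close> in \<open>OL\<close> lies in some
  \<open>A[\<alpha>']\<close> with \<open>\<alpha>'\<close> integral over \<open>A\<close>;
  conversely \<open>OL\<close> is integrally closed.\<close>

lemma integral_closure_eq: "integral_closure A = OL"
proof
  show "integral_closure A \<subseteq> OL"
    using OL_K by (intro integral_closure_subset) auto
  show "OL \<subseteq> integral_closure A"
  proof
    fix \<beta> assume "\<beta> \<in> OL"
    then obtain \<alpha> where aS: "\<alpha> \<in> S" and cov: "\<And>g. g \<in> A \<Longrightarrow> g * (\<alpha> - 1) / z \<in> ring_units OL \<Longrightarrow>
      \<beta> \<in> ring_adj A (g * (\<alpha> - 1) / z)" using ex_covering by blast
    obtain g where g: "g \<in> A" "g * (\<alpha> - 1) / z \<in> ring_units OL" using ex_normalizer[OF aS] .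
    note a = S_properties[OF aS]
    have "g * (\<alpha> - 1) / z \<in> integral_closure A"
      using a g by (intro normalized_integral) (auto simp: ring_units_iff)
    then show "\<beta> \<in> integral_closure A"
      using A.ring_adj_subset_integral_closure cov[OF g] by blast
  qed
qed

text \<open>Here \<open>\<alpha>1 = c \<alpha>2^j\<close> by Kummer theory. Expanding in powers of \<open>\<alpha>2 - 1 = (z / g2) y2\<close>, all coefficients
  of \<open>y1\<close> but the constant one are visibly in \<open>A\<close>, hence so is the constant one.\<close>
lemma ring_adj_chain:
  assumes S: "\<alpha>1 \<in> S" "\<alpha>2 \<in> S" and g: "g1 \<in> A" "g2 \<in> A" "g1 \<preceq> g2"
    and units: "g1 * (\<alpha>1 - 1) / z \<in> ring_units OL" "g2 * (\<alpha>2 - 1) / z \<in> ring_units OL"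
  shows "ring_adj A (g1 * (\<alpha>1 - 1) / z) \<subseteq> ring_adj A (g2 * (\<alpha>2 - 1) / z)"
proof -
  define y1 y2 where "y1 = g1 * (\<alpha>1 - 1) / z" and "y2 = g2 * (\<alpha>2 - 1) / z"
  have y1: "y1 \<preceq> 1" and y2: "y2 \<preceq> 1" "1 \<preceq> y2"
    using units by (simp_all add: y1_def y2_def ring_units_iff)
  have g2_0: "g2 \<noteq> 0" using y2 by (auto simp: y2_def)
  note a1 = S_properties[OF S(1)] and a2 = S_properties[OF S(2)]
  interpret a2: kummer_extension K p \<zeta> \<alpha>2
    by unfold_locales (use a2 p K zeta in auto)
  obtain c j where c: "c \<in> K" "\<alpha>1 = c * \<alpha>2 ^ j" by (rule a2.pth_root_in_K[OF a1(1)])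
  have c_int: "c \<preceq> 1"
  proof -
    have "1 \<preceq> \<alpha>2 ^ j" using vle_power[OF a2(4), of j] by simp
    then have "c * 1 \<preceq> \<alpha>1" unfolding c(2) by (intro vle_mult) auto
    then show ?thesis using a1(3) vle_trans by simp
  qed
  \<comment> \<open>\<open>\<alpha>2 = 1 + w * y2\<close>, and \<open>w\<close> has the value of
    \<open>\<alpha>2 - 1\<close>, so it is integral.\<close>
  define w where "w = z / g2"
  have w_y2: "w * y2 = \<alpha>2 - 1" using g2_0 z_nonzero by (simp add: w_def y2_def)
  have "w \<preceq> \<alpha>2 - 1" using vle_mult[OF vle_refl[of w] y2(2)] by (simp add: w_y2)
  moreover have "\<alpha>2 - 1 \<preceq> 1" using a2(3) by (intro vle_diff) auto
  ultimately have "w \<preceq> 1" by (rule vle_trans)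
  moreover have "w \<in> K" unfolding w_def using g zeta
    by (intro K.divide_mem K.diff_mem) (auto simp: mem_A_iff)
  ultimately have w: "w \<in> A" by (simp add: mem_A_iff)
  define u where "u = c * (g1 / g2)"
  have u: "u \<in> A"
    using c(1) c_int g g2_0 by (auto simp: u_def mem_A_iff divide_vle_one intro!: K.mult_mem K.divide_mem vle_one_mult)
  \<comment> \<open>This comes from \<open>\<alpha>1 - 1 = c (\<alpha>2 ^ j - 1) + (c - 1)\<close>
    and the geometric sum for \<open>\<alpha>2 ^ j - 1\<close>; the assumption
    \<open>g1 \<preceq> g2\<close> makes \<open>u\<close> integral.\<close>
  define P where "P = [:0, u:] * (\<Sum>i<j. [:1, w:] ^ i)"
  have P: "poly_over A P" unfolding P_def
    using u w by (intro A.poly_over_mult A.poly_over_sum A.poly_over_power A.poly_over_pCons) auto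
  define d where "d = g1 * (c - 1) / z"
  have P_y2: "poly P y2 = u * y2 * (\<Sum>i<j. \<alpha>2 ^ i)"
    using w_y2 by (simp add: P_def poly_sum poly_power mult.commute)
  have "c * (\<alpha>2 ^ j - 1) = c * w * y2 * (\<Sum>i<j. \<alpha>2 ^ i)"
    by (simp add: power_diff_1_eq w_y2[symmetric] mult.assoc)
  then have "g1 / z * (c * (\<alpha>2 ^ j - 1)) = poly P y2"
    using z_nonzero g2_0 by (simp add: P_y2 u_def w_def)
  moreover have "y1 = g1 / z * (c * (\<alpha>2 ^ j - 1)) + d"
    unfolding y1_def d_def c(2) by (simp add: algebra_simps flip: add_divide_distrib)
  ultimately have y1_eq: "y1 = poly P y2 + d" by simp
  have "d = y1 - poly P y2" using y1_eq by simp
  moreover have "poly P y2 \<preceq> 1"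
    using P y2(1) V.poly_mem[of P y2] by (simp add: poly_over_A_iff mem_iff_vle)
  ultimately have "d \<preceq> 1" using y1 by (simp add: vle_diff)
  moreover have "d \<in> K" unfolding d_def using g c zeta
    by (intro K.divide_mem K.mult_mem K.diff_mem) (auto simp: mem_A_iff)
  ultimately have d: "d \<in> A" by (simp add: mem_A_iff)
  define H where "H = P + [:d:]"
  have H: "poly_over A H" "poly H y2 = y1"
    using P d y1_eq by (auto simp: H_def intro!: A.poly_over_add A.poly_over_pCons)
  show ?thesis
    unfolding y1_def[symmetric] y2_def[symmetric]
  proof
    fix x assume "x \<in> ring_adj A y1"
    then obtain f where f: "poly_over A f" "x = poly f y1" by (auto simp: ring_adj_def)
    then have "x = poly (pcompose f H) y2" "poly_over A (pcompose f H)"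
      using H by (simp_all add: poly_pcompose A.poly_over_pcompose)
    then show "x \<in> ring_adj A y2" by (auto simp: ring_adj_def)
  qed
qed

end

section \<open>Properness of \<open>K\<close> and assembly of the theorem\<close>

lemma ext_degree_proper:
  assumes "ext_degree K n" "1 < n" "0 \<in> K" shows "K \<noteq> (UNIV :: 'a::field set)"
proof
  assume "K = UNIV"
  obtain b :: "nat \<Rightarrow> 'a" where indep: "\<And>c. (\<forall>i<n. c i \<in> K) \<Longrightarrow> (\<Sum>i<n. c i * b i) = 0 \<Longrightarrow> \<forall>i<n. c i = 0"
    using assms(1) unfolding ext_degree_def by blast
  have two: "(\<Sum>i<n. (if i = 0 then u else if i = 1 then v else 0) * b i) = u * b 0 + v * b 1" for u v
  proof -
    have "(\<Sum>i<n. (if i = 0 then u else if i = 1 then v else 0) * b i)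
        = (\<Sum>i\<in>{0, 1}. (if i = 0 then u else if i = 1 then v else 0) * b i)"
      using assms(2) by (intro sum.mono_neutral_right) auto
    then show ?thesis by simp
  qed
  have zero: "u = 0" if "u * b 0 + v * b 1 = 0" for u v
    using indep[of "\<lambda>i. if i = 0 then u else if i = 1 then v else 0"] two[of u v] that \<open>K = UNIV\<close> assms(2)
    by fastforce
  \<comment> \<open>With \<open>K\<close> everything, \<open>b 1 * b 0 - b 0 * b 1 = 0\<close> is a
    relation over \<open>K\<close>; it forces \<open>b 1 = 0\<close>, which again contradicts
    independence.\<close>
  have "b 1 = 0" using zero[of "b 1" "- b 0"] by simp
  have one: "v = 0" if "u * b 0 + v * b 1 = 0" for u v
    using indep[of "\<lambda>i. if i = 0 then u else if i = 1 then v else 0"] two[of u v] that \<open>K = UNIV\<close> assms(2)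
    by (auto dest: spec[of _ 1])
  show False using one[of 0 1] \<open>b 1 = 0\<close> by simp
qed

theorem theorem5p1:
  fixes K A OL :: "'a::field_char_0 set" and p :: nat and \<zeta> :: 'a
  assumes "subfield K"
    and "valuation_ring K A" and "henselian A"
    and "prime p" and "of_nat p \<in> max_ideal A"
    and "\<zeta> \<in> K" and "primitive_root p \<zeta>"
    and "kummer_ext K p"
    and "valuation_ring UNIV OL" and "OL \<inter> K = A"
    and "ram_index_one K OL" and "res_degree_one A OL"
  shows
   "let z = \<zeta> - 1; B = integral_closure A;
        A' = {h \<in> kummer_gens K p. h \<in> ring_units A \<and> h - 1 \<in> max_ideal A};
        S = {\<alpha>. \<alpha> ^ p \<in> A'}
    in (\<forall>\<alpha>\<in>S. \<exists>\<gamma>\<in>A. \<gamma> * (\<alpha> - 1) / z \<in> ring_units B) \<and>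
       (\<forall>g :: 'a \<Rightarrow> 'a. (\<forall>\<alpha>\<in>S. g \<alpha> \<in> A \<and> g \<alpha> * (\<alpha> - 1) / z \<in> ring_units B) \<longrightarrow>
          (\<forall>\<alpha>1\<in>S. \<forall>\<alpha>2\<in>S.
              ring_adj A (g \<alpha>1 * (\<alpha>1 - 1) / z) \<subseteq> ring_adj A (g \<alpha>2 * (\<alpha>2 - 1) / z) \<or>
              ring_adj A (g \<alpha>2 * (\<alpha>2 - 1) / z) \<subseteq> ring_adj A (g \<alpha>1 * (\<alpha>1 - 1) / z)) \<and>
          (\<forall>\<beta>\<in>B. \<exists>\<alpha>\<in>S. \<beta> \<in> ring_adj A (g \<alpha> * (\<alpha> - 1) / z)))"
proof -
  obtain \<theta> where theta: "\<theta> ^ p \<in> K" "generates K {\<theta>}"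
    using assms(8) by (auto simp: kummer_ext_def)
  have "K \<noteq> UNIV"
    using assms(1,4,8) by (intro ext_degree_proper[of _ p])
      (auto simp: kummer_ext_def subfield_def prime_gt_Suc_0_nat)
  then have "\<theta> \<notin> K"
    using theta(2)[unfolded generates_def, rule_format, of K] assms(1) by auto
  interpret defect_kummer OL K A p \<zeta> \<theta>
    by unfold_locales (use assms theta \<open>\<theta> \<notin> K\<close> in auto)
  show ?thesis
    unfolding Let_def S_def[symmetric] integral_closure_eq
  proof (intro conjI allI impI ballI)
    fix \<alpha> assume "\<alpha> \<in> S"
    then show "\<exists>\<gamma>\<in>A. \<gamma> * (\<alpha> - 1) / z \<in> ring_units OL" using ex_normalizer by blast
  next
    fix g :: "'a \<Rightarrow> 'a" and \<alpha>1 \<alpha>2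
    assume g: "\<forall>\<alpha>\<in>S. g \<alpha> \<in> A \<and> g \<alpha> * (\<alpha> - 1) / z \<in> ring_units OL"
      and S: "\<alpha>1 \<in> S" "\<alpha>2 \<in> S"
    \<comment> \<open>The values of the normalizers decide the inclusion: the element closer to 1
      gives the larger ring.\<close>
    show "ring_adj A (g \<alpha>1 * (\<alpha>1 - 1) / z) \<subseteq> ring_adj A (g \<alpha>2 * (\<alpha>2 - 1) / z) \<or>
        ring_adj A (g \<alpha>2 * (\<alpha>2 - 1) / z) \<subseteq> ring_adj A (g \<alpha>1 * (\<alpha>1 - 1) / z)"
      using vle_total[of "g \<alpha>1" "g \<alpha>2"]
    proof
      assume "g \<alpha>1 \<preceq> g \<alpha>2"
      from ring_adj_chain[OF S _ _ this] show ?thesis using g S by simp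
    next
      assume "g \<alpha>2 \<preceq> g \<alpha>1"
      from ring_adj_chain[OF S(2,1) _ _ this] show ?thesis using g S by simp
    qed
  next
    fix g :: "'a \<Rightarrow> 'a" and \<beta>
    assume g: "\<forall>\<alpha>\<in>S. g \<alpha> \<in> A \<and> g \<alpha> * (\<alpha> - 1) / z \<in> ring_units OL" and "\<beta> \<in> OL"
    obtain \<alpha> where "\<alpha> \<in> S" and cov: "\<And>g. g \<in> A \<Longrightarrow> g * (\<alpha> - 1) / z \<in> ring_units OL \<Longrightarrow>
        \<beta> \<in> ring_adj A (g * (\<alpha> - 1) / z)"
      using ex_covering[OF \<open>\<beta> \<in> OL\<close>] by blast
    with cov[of "g \<alpha>"] g show "\<exists>\<alpha>\<in>S. \<beta> \<in> ring_adj A (g \<alpha> * (\<alpha> - 1) / z)" by blast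
  qed
qed

end
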